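(* Let $k\in\frac12\mathbb Z$ with $k<2$ and let $N$ be a positive integer. Let $(a^\pm(n))_{n\ge0}$, $(b^\pm(n))_{n\ge0}$ be sequences of complex numbers such that $a^\pm(n)=O(n^{\mu_f^\pm})$ and $b^\pm(n)=O(n^{\mu_g^\pm})$ for some $\mu_f^\pm,\mu_g^\pm\ge0$. Suppose that for all $$\rho>\max\left(1-k,\ \mu_g^+-\frac k2+\frac34,\ 2\mu_g^--2k+\frac52\right)$$ and all $x>0$ the following identity holds: $$\frac{1}{\Gamma(\rho+1)}\sum_{1\le n\le x}a^+(n)(x-n)^\rho+\frac{x^\rho}{2\pi i}\sum_{1\le n\le x}a^-(n)g_\rho(n,x)-Q_\rho(x)$$ $$=-i^k x^{\frac{\rho+k}{2}}\Big(\frac{\sqrt N}{2\pi}\Big)^{\rho}\sum_{n=1}^\infty\frac{b^+(n)}{n^{(\rho+k)/2}}J_{\rho+k}\Big(4\pi\sqrt{\tfrac{nx}{N}}\Big)$$ $$\quad- i^k x^{\frac{\rho+1}{2}}\Big(\frac{\sqrt N}{2\pi}\Big)^{\rho+k-1}\sum_{n=1}^\infty\frac{b^-(n)}{n^{\frac{\rho-1}{2}+k}}\int_0^{1/2}\frac{u^{k+\frac{\rho-3}{2}}}{(1-u)^{\frac{1+\rho}{2}}}J_{\rho+1}\Big(4\pi\sqrt{\tfrac{nx(1-u)}{Nu}}\Big)du,$$ where $Q_\rho$ and $g_\rho$ are defined in the context. Then for all $y>0$, $$\sum_{n=1}^\infty a^+(n)e^{-ny}+\sum_{n=1}^\infty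 a^-(n)e^{ny}\Gamma(1-k,2ny)+a^+(0)-\frac{2\pi N^{\frac k2-1}i^k}{y}b^-(0)+\frac{(2\pi)^{k-1}}{y^{k-1}}a^-(0)-\frac{i^k(2\pi)^k}{N^{k/2}y^k}b^+(0)$$ $$=-\left(\frac{2\pi i}{\sqrt N y}\right)^k\sum_{n=1}^\infty b^+(n)e^{-\frac{4n\pi^2}{Ny}}-\left(\frac{2\pi i}{\sqrt Ny}\right)^k\sum_{n=1}^\infty b^-(n)e^{\frac{4n\pi^2}{Ny}}\Gamma\left(1-k,\frac{8n\pi^2}{Ny}\right).$$
   Context: Complex powers use the principal branch. $J_\nu$ is the Bessel function of the first kind and $\Gamma(s,z)=\int_z^\infty t^{s-1}e^{-t}dt$ ($z>0$). The functions in the hypothesis are $$Q_\rho(x)=x^\rho\left(-\frac{a^+(0)}{\Gamma(\rho+1)}+\frac{2\pi xN^{\frac k2-1}b^-(0)i^k}{\Gamma(\rho+2)}-\frac{a^-(0)x^{k-1}(2\pi)^{k-1}}{\Gamma(\rho+k)}+\frac{b^+(0)i^kx^k(2\pi)^k}{N^{k/2}\Gamma(\rho+k+1)}\right),$$ $$g_\rho(n,x)=\frac{2\pi i}{\Gamma(k+\rho)}\Big(1+\frac nx\Big)^\rho\int_{\frac{2n}{x+n}}^1 t^{-k}(1-t)^{k+\rho-1}\,dt .$$ *)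

theory Defs
  imports "HOL-Analysis.Analysis" "HOL-Library.Landau_Symbols"
begin

text \<open>
  Real powers of nonnegative reals are real \<open>powr\<close>; powers of complex numbers use complex
  \<open>powr\<close>, which is the principal branch.
\<close>

text \<open>The power series of \<open>J\<^sub>\<nu>(x)\<close>, for real order and \<open>x > 0\<close>.\<close>

definition bessel_J :: "real \<Rightarrow> real \<Rightarrow> real" where
  "bessel_J \<nu> x =
     (\<Sum>m. (-1) ^ m / fact m * rGamma (real m + \<nu> + 1) * (x / 2) powr (2 * real m + \<nu>))"

definition upper_Gamma :: "real \<Rightarrow> real \<Rightarrow> real" where
  "upper_Gamma s z = (LBINT t=ereal z..\<infinity>. t powr (s - 1) * exp (- t))"

text \<open>The arguments \<open>ap\<close>, \<open>am\<close>, \<open>bp\<close>, \<open>bm\<close> stand for \<open>a\<^sup>+\<close>, \<open>a\<^sup>-\<close>, \<open>b\<^sup>+\<close>, \<open>b\<^sup>-\<close>.\<close>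

definition Q_fun ::
  "real \<Rightarrow> nat \<Rightarrow> (nat \<Rightarrow> complex) \<Rightarrow> (nat \<Rightarrow> complex) \<Rightarrow> (nat \<Rightarrow> complex) \<Rightarrow> (nat \<Rightarrow> complex)
     \<Rightarrow> real \<Rightarrow> real \<Rightarrow> complex" where
  "Q_fun k N ap am bp bm \<rho> x =
     of_real (x powr \<rho>) *
       (- (ap 0 / of_real (Gamma (\<rho> + 1)))
        + of_real (2 * pi * x * real N powr (k / 2 - 1)) * bm 0 * \<i> powr of_real k
            / of_real (Gamma (\<rho> + 2))
        - am 0 * of_real (x powr (k - 1) * (2 * pi) powr (k - 1)) / of_real (Gamma (\<rho> + k))
        + bp 0 * \<i> powr of_real k * of_real (x powr k * (2 * pi) powr k)
            / of_real (real N powr (k / 2) * Gamma (\<rho> + k + 1)))"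

definition g_fun :: "real \<Rightarrow> real \<Rightarrow> nat \<Rightarrow> real \<Rightarrow> complex" where
  "g_fun k \<rho> n x =
     2 * of_real pi * \<i> / of_real (Gamma (k + \<rho>)) * of_real ((1 + real n / x) powr \<rho>) *
       of_real (LBINT t=ereal (2 * real n / (x + real n))..1.
                  t powr (- k) * (1 - t) powr (k + \<rho> - 1))"

end

theory Submission
  imports Defs "HOL-Real_Asymp.Real_Asymp"
begin

text \<open>
  Apply the Laplace transform \<open>\<integral>\<^sub>0\<^sup>\<infinity> exp (- x y) (\<dots>) dx\<close> to both sides of the identity for one
  large \<open>\<rho>\<close> and multiply by \<open>y powr (\<rho> + 1)\<close>. For large \<open>\<rho>\<close> the boundedness of \<open>J\<^sub>\<nu>\<close> on
  \<open>x > 0\<close> makes all interchanges of sum and integral absolutely convergent. The \<open>a\<^sup>-\<close> terms become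
  convolutions after the substitution \<open>s = t (x + n)\<close>, the \<open>b\<^sup>+\<close> terms follow from the transform
  \<open>a powr (\<nu> / 2) y powr (- \<nu> - 1) exp (- a / y)\<close> of \<open>x powr (\<nu> / 2) J\<^sub>\<nu> (2 sqrt (a x))\<close>, and the
  \<open>b\<^sup>-\<close> terms from the same transform under the \<open>u\<close>-integral, followed by \<open>u = A / t\<close> with
  \<open>A = 4 \<pi>\<^sup>2 n / (N y)\<close>.
\<close>

text \<open>The hypothesis is a Riesz-mean identity: (x - n)^rho / Gamma(rho + 1), cut off at x = n,
  transforms to exp (- n y) y^(-rho-1), and every other term also becomes y^(-rho-1) times its
  counterpart in the conclusion. So rho cancels, and only the forward transform is needed: equal
  functions have equal transforms. The obstacle is the exchange of sum and integral on the Bessel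
  side. The hypothesis grants convergence of those series, possibly only conditional. For large rho
  the coefficients over their powers of n are absolutely summable, and a bound on the Bessel factors
  uniform in n then suffices. The incomplete Gamma functions come from truncated ranges. The weight
  s^(-k) on s > 2 n transforms to y^(k-1) Gamma(1 - k, 2 n y), and advancing the argument by n
  contributes exp (n y). Dually, the u-integral carries exp (- A (1 - u) / u) = exp A exp (- t) with
  t = A / u, and u < 1/2 means t > 2 A; this explains both the growing exponential and the doubled
  argument.\<close>

subsection \<open>Laplace transforms\<close>

text \<open>Existence and value travel together, so each computed transform also records
  integrability. The open half-line makes the values of \<open>f\<close> at x <= 0
  irrelevant.\<close>

definition has_laplace :: "(real \<Rightarrow> 'a::{banach, second_countable_topology}) \<Rightarrow> real \<Rightarrow> 'a \<Rightarrow> bool" where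
  "has_laplace f y F \<longleftrightarrow>
     has_bochner_integral lborel (\<lambda>x. (indicator {0<..} x * exp (- (x * y))) *\<^sub>R f x) F"

lemma has_laplace_cong:
  assumes "\<And>x. x > 0 \<Longrightarrow> f x = g x" "F = G"
  shows "has_laplace f y F \<longleftrightarrow> has_laplace g y G"
  unfolding has_laplace_def
  by (intro has_bochner_integral_cong) (use assms in \<open>auto split: split_indicator\<close>)

text \<open>Injectivity of the transform is not at stake: the final argument computes the transform
  of a single function in two ways.\<close>

lemma has_laplace_unique: "has_laplace f y F \<Longrightarrow> has_laplace f y G \<Longrightarrow> F = G"
  unfolding has_laplace_def by (rule has_bochner_integral_eq)

lemma has_laplace_add:
  "has_laplace f y F \<Longrightarrow> has_laplace g y G \<Longrightarrow> has_laplace (\<lambda>x. f x + g x) y (F + G)"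
  unfolding has_laplace_def using has_bochner_integral_add by (fastforce simp: scaleR_add_right)

lemma has_laplace_mult:
  fixes c :: "'a :: {real_normed_field, banach, second_countable_topology}"
  shows "has_laplace f y F \<Longrightarrow> has_laplace (\<lambda>x. c * f x) y (c * F)"
  unfolding has_laplace_def using has_bochner_integral_mult_right[of c] by fastforce

lemma has_laplace_of_real:
  "has_laplace f y F \<Longrightarrow> has_laplace (\<lambda>x. complex_of_real (f x)) y (of_real F)"
  unfolding has_laplace_def
  by (drule has_bochner_integral_of_real[where 'a=complex]) (simp add: scaleR_conv_of_real)

text \<open>For nonnegative functions a finite nonnegative integral already yields Bochner
  integrability, so powers and convolutions can be handled in \<open>ennreal\<close> with no
  separate integrability proof.\<close>

lemma has_laplaceI_nn:
  fixes f :: "real \<Rightarrow> real"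
  assumes [measurable]: "f \<in> borel_measurable borel" and "\<And>x. x > 0 \<Longrightarrow> f x \<ge> 0" "F \<ge> 0"
    and "(\<integral>\<^sup>+x. ennreal (indicator {0<..} x * exp (- (x * y)) * f x) \<partial>lborel) = ennreal F"
  shows "has_laplace f y F"
  unfolding has_laplace_def
  by (rule has_bochner_integral_nn_integral) (use assms in \<open>auto split: split_indicator\<close>)

lemma has_laplace_powr:
  assumes "\<nu> > -1" "y > 0"
  shows "has_laplace (\<lambda>x. x powr \<nu>) y (Gamma (\<nu> + 1) * y powr (- \<nu> - 1))"
proof (rule has_laplaceI_nn)
  let ?f = "\<lambda>t::real. ennreal (indicator {0..} t * t powr \<nu> / exp t)"
  have "ennreal (Gamma (\<nu> + 1)) = (\<integral>\<^sup>+t. ?f t \<partial>lborel)"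
    using Gamma_conv_nn_integral_real[of "\<nu> + 1"] assms by simp
  also have "\<dots> = y * (\<integral>\<^sup>+x. ?f (0 + y * x) \<partial>lborel)"
    using assms by (subst nn_integral_real_affine[where c=y and t=0]) auto
  \<comment> \<open>After t = y x the power splits. Closed and open half-lines agree here because
    \<open>0 powr \<nu> = 0\<close>.\<close>
  also have "(\<integral>\<^sup>+x. ?f (0 + y * x) \<partial>lborel) =
      (\<integral>\<^sup>+x. ennreal (y powr \<nu>) * ennreal (indicator {0<..} x * exp (- (x * y)) * x powr \<nu>) \<partial>lborel)"
    using assms by (intro nn_integral_cong)
      (auto simp: ennreal_mult'[symmetric] powr_mult exp_minus field_simps zero_le_mult_iff
        split: split_indicator)
  also have "\<dots> = ennreal (y powr \<nu>) *
      (\<integral>\<^sup>+x. ennreal (indicator {0<..} x * exp (- (x * y)) * x powr \<nu>) \<partial>lborel)"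
    by (intro nn_integral_cmult) auto
  finally have *: "ennreal (Gamma (\<nu> + 1)) = ennreal y * (ennreal (y powr \<nu>) *
      (\<integral>\<^sup>+x. ennreal (indicator {0<..} x * exp (- (x * y)) * x powr \<nu>) \<partial>lborel))" (is "_ = _ * (_ * ?I)") .
  have "ennreal (Gamma (\<nu> + 1) * y powr (- \<nu> - 1)) = ennreal (y powr (-\<nu> - 1)) * ennreal (Gamma (\<nu> + 1))"
    using assms by (subst ennreal_mult'[symmetric]) (auto simp: mult.commute)
  also have "\<dots> = ennreal (y powr (-\<nu> - 1) * (y * y powr \<nu>)) * ?I"
    unfolding * using assms by (simp add: ennreal_mult mult.assoc)
  also have "y powr (-\<nu> - 1) * (y * y powr \<nu>) = 1"
    using assms by (simp add: powr_diff powr_minus field_simps)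
  finally show "?I = ennreal (Gamma (\<nu> + 1) * y powr (- \<nu> - 1))" by simp
qed (use assms in \<open>auto intro!: mult_nonneg_nonneg\<close>)

text \<open>The transforms \<open>P n\<close> bound the L1 norms of the weighted \<open>f n\<close>,
  so summability of \<open>P\<close> justifies the exchange. The majorant may vary with n and x
  jointly, which the power series of the Bessel function requires.\<close>

lemma has_laplace_suminf:
  fixes f :: "nat \<Rightarrow> real \<Rightarrow> 'a::{banach, second_countable_topology}"
  assumes f: "\<And>n. has_laplace (f n) y (F n)"
    and p: "\<And>n. has_laplace (p n) y (P n)"
    and le: "\<And>n x. x > 0 \<Longrightarrow> norm (f n x) \<le> p n x"
    and sp: "\<And>x. x > 0 \<Longrightarrow> summable (\<lambda>n. p n x)" and sP: "summable P"
  shows "has_laplace (\<lambda>x. \<Sum>n. f n x) y (\<Sum>n. F n)" "summable (\<lambda>n. norm (F n))"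
proof -
  let ?w = "\<lambda>x. indicator {0<..} x * exp (- (x * y)) :: real"
  have int: "integrable lborel (\<lambda>x. ?w x *\<^sub>R f n x)" and F: "(\<integral>x. ?w x *\<^sub>R f n x \<partial>lborel) = F n" for n
    using f unfolding has_laplace_def has_bochner_integral_iff by auto
  have nle: "(\<integral>x. norm (?w x *\<^sub>R f n x) \<partial>lborel) \<le> P n" for n
  proof -
    have "(\<integral>x. norm (?w x *\<^sub>R f n x) \<partial>lborel) \<le> (\<integral>x. ?w x *\<^sub>R p n x \<partial>lborel)"
      using integrable_norm[OF int[of n]] p[of n] le unfolding has_laplace_def has_bochner_integral_iff
      by (intro integral_mono) (auto simp: abs_mult split: split_indicator)
    then show ?thesis using p[of n] unfolding has_laplace_def has_bochner_integral_iff by simp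
  qed
  have sn: "summable (\<lambda>n. \<integral>x. norm (?w x *\<^sub>R f n x) \<partial>lborel)"
    by (rule summable_comparison_test'[OF sP, of 0]) (use nle in auto)
  have sf: "summable (\<lambda>n. norm (f n x))" if "x > 0" for x
    by (rule summable_comparison_test'[OF sp[OF that], of 0]) (use le that in auto)
  have ae: "AE x in lborel. summable (\<lambda>n. norm (?w x *\<^sub>R f n x))"
    using sf by (intro AE_I2) (auto intro!: summable_mult split: split_indicator)
  have "has_bochner_integral lborel (\<lambda>x. \<Sum>n. ?w x *\<^sub>R f n x) (\<Sum>n. F n)"
    unfolding has_bochner_integral_iff
    using integrable_suminf[OF int ae sn] integral_suminf[OF int ae sn] F by simp
  moreover have "(\<Sum>n. ?w x *\<^sub>R f n x) = ?w x *\<^sub>R (\<Sum>n. f n x)" for x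
    using sf[THEN summable_norm_cancel] by (cases "x > 0") (auto simp: suminf_scaleR_right)
  ultimately show "has_laplace (\<lambda>x. \<Sum>n. f n x) y (\<Sum>n. F n)"
    unfolding has_laplace_def by simp
  have "norm (F n) \<le> P n" for n
    using nle[of n] integral_norm_bound[of lborel "\<lambda>x. ?w x *\<^sub>R f n x"] F[of n] by simp
  then show "summable (\<lambda>n. norm (F n))"
    by (intro summable_comparison_test'[OF sP, of 0]) auto
qed

text \<open>Translation by a costs exp (- a y). The closed indicator matches sums over n <= x; at x
  = a the power is \<open>0 powr \<nu> = 0\<close>, so the endpoint contributes nothing.\<close>

lemma has_laplace_shift:
  assumes "\<nu> > -1" "y > 0" "a \<ge> 0"
  shows "has_laplace (\<lambda>x. indicator {a..} x * (x - a) powr \<nu>) y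
           (Gamma (\<nu> + 1) * (exp (- (a * y)) * y powr (- \<nu> - 1)))"
proof -
  let ?g = "\<lambda>x. (indicator {0<..} x * exp (- (x * y))) *\<^sub>R (x powr \<nu>)"
  have "has_bochner_integral lborel ?g (Gamma (\<nu> + 1) * y powr (- \<nu> - 1))"
    using has_laplace_powr[OF assms(1,2)] unfolding has_laplace_def .
  then have "has_bochner_integral lborel (\<lambda>x. ?g (- a + 1 * x)) (Gamma (\<nu> + 1) * y powr (- \<nu> - 1))"
    by (subst (asm) lborel_has_bochner_integral_real_affine_iff[of 1 _ _ "-a"]) auto
  then have "has_bochner_integral lborel (\<lambda>x. exp (- (a * y)) * ?g (- a + 1 * x))
      (exp (- (a * y)) * (Gamma (\<nu> + 1) * y powr (- \<nu> - 1)))"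
    by (intro has_bochner_integral_mult_right) 
  then have "has_bochner_integral lborel (\<lambda>x. exp (- (a * y)) * ?g (- a + 1 * x))
      (Gamma (\<nu> + 1) * (exp (- (a * y)) * y powr (- \<nu> - 1)))"
    by (simp add: mult_ac)
  then show ?thesis
    unfolding has_laplace_def
  proof (rule has_bochner_integral_cong[THEN iffD1, rotated -1])
    fix x :: real
    have e: "exp (- (a * y)) * exp (- ((x - a) * y)) = exp (- (x * y))"
      by (simp add: exp_add[symmetric] algebra_simps)
    show "exp (- (a * y)) * ?g (- a + 1 * x) =
      (indicator {0<..} x * exp (- (x * y))) *\<^sub>R (indicator {a..} x * (x - a) powr \<nu>)"
      using e assms by (auto split: split_indicator)
  qed auto
qed

subsection \<open>Convolutions and the incomplete Gamma function\<close>

text \<open>Advancing the argument would lose the mass of \<open>f\<close> on (0, a]; assumption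
  \<open>z\<close> says that there is none, so only the factor exp (a y) remains.\<close>

lemma has_laplace_translate:
  fixes f :: "real \<Rightarrow> real"
  assumes "has_laplace f y F" "a \<ge> 0" and z: "\<And>x. 0 < x \<Longrightarrow> x \<le> a \<Longrightarrow> f x = 0"
  shows "has_laplace (\<lambda>x. f (x + a)) y (exp (a * y) * F)"
proof -
  let ?g = "\<lambda>x. (indicator {0<..} x * exp (- (x * y))) *\<^sub>R f x"
  have "has_bochner_integral lborel (\<lambda>x. ?g (a + 1 * x)) F"
    using assms(1) unfolding has_laplace_def
    by (subst (asm) lborel_has_bochner_integral_real_affine_iff[of 1 _ _ "a"]) auto
  then have "has_bochner_integral lborel (\<lambda>x. exp (a * y) * ?g (a + 1 * x)) (exp (a * y) * F)"
    by (intro has_bochner_integral_mult_right)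
  then show ?thesis
    unfolding has_laplace_def
  proof (rule has_bochner_integral_cong[THEN iffD1, rotated -1])
    fix x :: real
    have e: "exp (a * y) * exp (- ((a + x) * y)) = exp (- (x * y))"
      by (simp add: exp_add[symmetric] algebra_simps)
    show "exp (a * y) * ?g (a + 1 * x) = (indicator {0<..} x * exp (- (x * y))) *\<^sub>R f (x + a)"
      using e assms(2) z[of "a + x"]
      by (cases "x > 0"; cases "a + x > 0") (auto simp: add_ac)
  qed auto
qed

text \<open>Tonelli, after writing exp (- x y) as exp (- s y) exp (- (x - s) y). Assumption
  \<open>int\<close> makes the Bochner integral agree with the nonnegative one instead of defaulting
  to 0.\<close>

lemma has_laplace_convolution:
  fixes f g :: "real \<Rightarrow> real"
  assumes [measurable]: "f \<in> borel_measurable borel" "g \<in> borel_measurable borel"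
    and fn: "\<And>x. f x \<ge> 0" and gn: "\<And>x. g x \<ge> 0"
    and F: "has_laplace f y F" and G: "has_laplace g y G"
    and int: "\<And>x. x > 0 \<Longrightarrow> integrable lborel (\<lambda>s. indicator {0<..<x} s * (f s * g (x - s)))"
  shows "has_laplace (\<lambda>x. LBINT s. indicator {0<..<x} s * (f s * g (x - s))) y (F * G)"
proof (rule has_laplaceI_nn)
  let ?w = "\<lambda>x. indicator {0<..} x * exp (- (x * y)) :: real"
  let ?h = "\<lambda>x s. indicator {0<..<x} s * (f s * g (x - s))"
  have nF: "(\<integral>\<^sup>+s. ennreal (?w s * f s) \<partial>lborel) = ennreal F" and "F \<ge> 0"
    using F fn unfolding has_laplace_def has_bochner_integral_iff
    by (auto simp: nn_integral_eq_integral integral_nonneg_AE)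
  have nG: "(\<integral>\<^sup>+s. ennreal (?w s * g s) \<partial>lborel) = ennreal G" and "G \<ge> 0"
    using G gn unfolding has_laplace_def has_bochner_integral_iff
    by (auto simp: nn_integral_eq_integral integral_nonneg_AE)
  show "0 \<le> F * G" using \<open>F \<ge> 0\<close> \<open>G \<ge> 0\<close> by simp
  \<comment> \<open>The range of s moves with x, so its indicator has to be measurable in the
    pair.\<close>
  have [measurable]: "Measurable.pred (borel \<Otimes>\<^sub>M borel) (\<lambda>x::real \<times> real. snd x \<in> {0<..<fst x})"
    unfolding greaterThanLessThan_iff by measurable
  show "(\<lambda>x. LBINT s. ?h x s) \<in> borel_measurable borel"
    by measurable
  show "0 \<le> (LBINT s. ?h x s)" for x
    by (intro integral_nonneg_AE) (auto simp: fn gn)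
  have "(\<integral>\<^sup>+x. ennreal (?w x * (LBINT s. ?h x s)) \<partial>lborel) =
        (\<integral>\<^sup>+x. \<integral>\<^sup>+s. ennreal (?w s * f s) * ennreal (?w (x - s) * g (x - s)) \<partial>lborel \<partial>lborel)"
  proof (rule nn_integral_cong)
    fix x :: real
    show "ennreal (?w x * (LBINT s. ?h x s)) =
        (\<integral>\<^sup>+s. ennreal (?w s * f s) * ennreal (?w (x - s) * g (x - s)) \<partial>lborel)"
    proof (cases "x > 0")
      case True
      \<comment> \<open>The half-line indicators in s and in x - s together cut out 0 < s <
        x.\<close>
      have "(\<integral>\<^sup>+s. ennreal (?w s * f s) * ennreal (?w (x - s) * g (x - s)) \<partial>lborel) =
            (\<integral>\<^sup>+s. ennreal (exp (- (x * y))) * ennreal (?h x s) \<partial>lborel)"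
      proof (rule nn_integral_cong)
        fix s
        have e: "exp (- (s * y)) * exp (- ((x - s) * y)) = exp (- (x * y))"
          by (simp add: exp_add[symmetric] algebra_simps)
        show "ennreal (?w s * f s) * ennreal (?w (x - s) * g (x - s)) =
            ennreal (exp (- (x * y))) * ennreal (?h x s)"
          using fn[of s] gn[of "x - s"] e[symmetric]
          by (auto simp: ennreal_mult'[symmetric] split: split_indicator)
      qed
      also have "\<dots> = ennreal (exp (- (x * y))) * (\<integral>\<^sup>+s. ennreal (?h x s) \<partial>lborel)"
        by (intro nn_integral_cmult) measurable
      also have "(\<integral>\<^sup>+s. ennreal (?h x s) \<partial>lborel) = ennreal (LBINT s. ?h x s)"
        by (intro nn_integral_eq_integral int True) (auto simp: fn gn)
      finally show ?thesis
        using True by (simp add: ennreal_mult'[symmetric])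
    next
      case False
      have "ennreal (?w s * f s) * ennreal (?w (x - s) * g (x - s)) = 0" for s
        using False by (auto split: split_indicator)
      then show ?thesis using False by (simp only: nn_integral_const) simp
    qed
  qed
  \<comment> \<open>After the exchange the inner integral is a translate of the transform of
    \<open>g\<close>, hence G for every s.\<close>
  also have "\<dots> = (\<integral>\<^sup>+s. \<integral>\<^sup>+x. ennreal (?w s * f s) * ennreal (?w (x - s) * g (x - s)) \<partial>lborel \<partial>lborel)"
    by (rule lborel_pair.Fubini') measurable
  also have "\<dots> = (\<integral>\<^sup>+s. ennreal (?w s * f s) * ennreal G \<partial>lborel)"
  proof (rule nn_integral_cong)
    fix s
    have "(\<integral>\<^sup>+x. ennreal (?w x * g x) \<partial>lborel) = (\<integral>\<^sup>+x. ennreal (?w (x - s) * g (x - s)) \<partial>lborel)"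
      by (subst nn_integral_real_affine[where c=1 and t="-s"]) auto
    then have "(\<integral>\<^sup>+x. ennreal (?w (x - s) * g (x - s)) \<partial>lborel) = ennreal G"
      using nG by simp
    moreover have "(\<integral>\<^sup>+x. ennreal (?w s * f s) * ennreal (?w (x - s) * g (x - s)) \<partial>lborel) =
        ennreal (?w s * f s) * (\<integral>\<^sup>+x. ennreal (?w (x - s) * g (x - s)) \<partial>lborel)"
      by (rule nn_integral_cmult) measurable
    ultimately show "(\<integral>\<^sup>+x. ennreal (?w s * f s) * ennreal (?w (x - s) * g (x - s)) \<partial>lborel) =
        ennreal (?w s * f s) * ennreal G" by simp
  qed
  also have "\<dots> = ennreal (F * G)"
    using nF \<open>G \<ge> 0\<close> \<open>F \<ge> 0\<close> by (subst nn_integral_multc) (auto simp: ennreal_mult)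
  finally show "(\<integral>\<^sup>+x. ennreal (?w x * (LBINT s. ?h x s)) \<partial>lborel) = ennreal (F * G)" .
qed

text \<open>Here s is an arbitrary real, since 1 - k may be negative. Above z the integrand is at
  most z^(s-1-|s|) t^|s| exp (- t), because the exponent s - 1 - |s| is negative; the integral of
  this majorant over t > 0 is a Gamma value.\<close>

lemma has_bochner_integral_upper_Gamma:
  assumes "z > 0"
  shows "has_bochner_integral lborel (\<lambda>t. indicator {z<..} t * (t powr (s - 1) * exp (- t))) (upper_Gamma s z)"
proof -
  have "has_laplace (\<lambda>x. z powr (s - 1 - \<bar>s\<bar>) * x powr \<bar>s\<bar>) 1
      (z powr (s - 1 - \<bar>s\<bar>) * (Gamma (\<bar>s\<bar> + 1) * 1 powr (- \<bar>s\<bar> - 1)))"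
    by (intro has_laplace_mult has_laplace_powr) auto
  then have "integrable lborel (\<lambda>x. (indicator {0<..} x * exp (- (x * 1))) *\<^sub>R (z powr (s - 1 - \<bar>s\<bar>) * x powr \<bar>s\<bar>))"
    unfolding has_laplace_def by (rule has_bochner_integral_iff[THEN iffD1, THEN conjunct1])
  then have "integrable lborel (\<lambda>t. indicator {z<..} t * (t powr (s - 1) * exp (- t)))"
  proof (rule Bochner_Integration.integrable_bound)
    show "AE x in lborel. norm (indicator {z<..} x * (x powr (s - 1) * exp (- x)))
       \<le> norm ((indicator {0<..} x * exp (- (x * 1))) *\<^sub>R (z powr (s - 1 - \<bar>s\<bar>) * x powr \<bar>s\<bar>))"
    proof (intro AE_I2)
      fix x
      have "x powr (s - 1) \<le> z powr (s - 1 - \<bar>s\<bar>) * x powr \<bar>s\<bar>" if "x > z"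
      proof -
        have "x powr (s - 1) = x powr (s - 1 - \<bar>s\<bar>) * x powr \<bar>s\<bar>"
          using that assms by (simp add: powr_add[symmetric])
        also have "\<dots> \<le> z powr (s - 1 - \<bar>s\<bar>) * x powr \<bar>s\<bar>"
          using that assms by (intro mult_right_mono powr_mono2') auto
        finally show ?thesis .
      qed
      then show "norm (indicator {z<..} x * (x powr (s - 1) * exp (- x)))
       \<le> norm ((indicator {0<..} x * exp (- (x * 1))) *\<^sub>R (z powr (s - 1 - \<bar>s\<bar>) * x powr \<bar>s\<bar>))"
        using assms by (auto split: split_indicator)
    qed
  qed measurable
  moreover have "upper_Gamma s z = (LBINT t. indicator {z<..} t * (t powr (s - 1) * exp (- t)))"
    by (simp add: upper_Gamma_def interval_lebesgue_integral_def set_lebesgue_integral_def)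
  ultimately show ?thesis by (simp add: has_bochner_integral_iff)
qed

lemma has_laplace_powr_above:
  assumes "a > 0" "y > 0"
  shows "has_laplace (\<lambda>x. indicator {a<..} x * x powr (s - 1)) y (y powr (- s) * upper_Gamma s (a * y))"
proof -
  let ?g = "\<lambda>t. indicator {a * y<..} t * (t powr (s - 1) * exp (- t))"
  have "has_bochner_integral lborel (\<lambda>x. ?g (0 + y * x)) (upper_Gamma s (a * y) / y)"
    using lborel_has_bochner_integral_real_affine_iff[of y ?g _ 0, THEN iffD1,
        OF _ has_bochner_integral_upper_Gamma[OF mult_pos_pos[OF assms]]] assms
    by (simp add: field_simps)
  then have "has_bochner_integral lborel (\<lambda>x. y powr (1 - s) * ?g (0 + y * x))
      (y powr (1 - s) * (upper_Gamma s (a * y) / y))"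
    by (intro has_bochner_integral_mult_right)
  also have "y powr (1 - s) * (upper_Gamma s (a * y) / y) = y powr (- s) * upper_Gamma s (a * y)"
    using assms by (simp add: powr_diff powr_minus field_simps)
  finally show ?thesis
    unfolding has_laplace_def
  proof (rule has_bochner_integral_cong[THEN iffD1, rotated -1])
    fix x :: real
    have "y powr (1 - s) * (y * x) powr (s - 1) = x powr (s - 1)" if "x > a"
      using that assms by (simp add: powr_mult powr_diff field_simps)
    then show "y powr (1 - s) * ?g (0 + y * x) =
       (indicator {0<..} x * exp (- (x * y))) *\<^sub>R (indicator {a<..} x * x powr (s - 1))"
      using assms by (auto simp: mult_ac split: split_indicator)
  qed auto
qed

lemma upper_Gamma_nonneg: "z > 0 \<Longrightarrow> upper_Gamma s z \<ge> 0"
  by (subst has_bochner_integral_integral_eq[OF has_bochner_integral_upper_Gamma, symmetric]) auto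

text \<open>Split exp (- t) into exp (- 3 t / 4) exp (- t / 4): the first factor is at most exp (- 3
  z / 4), and the second keeps the remaining integral finite. The rate has to exceed 1/2, because at
  z = 2 n y it must beat exp (n y).\<close>

lemma upper_Gamma_le:
  assumes "0 < z0" "z0 \<le> z"
  shows "upper_Gamma s z \<le> (1 / 4) powr (- s) * upper_Gamma s (z0 / 4) * exp (- 3 * z / 4)"
proof -
  let ?f = "\<lambda>x. (indicator {0<..} x * exp (- (x * (1/4)))) *\<^sub>R (indicator {z0<..} x * x powr (s - 1)) :: real"
  have *: "has_bochner_integral lborel ?f ((1 / 4) powr (- s) * upper_Gamma s (z0 / 4))"
    using has_laplace_powr_above[of z0 "1/4" s] assms unfolding has_laplace_def by simp
  have "upper_Gamma s z = (LBINT t. indicator {z<..} t * (t powr (s - 1) * exp (- t)))"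
    using has_bochner_integral_upper_Gamma[of z s] assms by (simp add: has_bochner_integral_iff)
  also have "\<dots> \<le> (LBINT t. exp (- 3 * z / 4) * ?f t)"
  proof (rule integral_mono)
    fix t
    have "exp (- t) \<le> exp (- 3 * z / 4) * exp (- (t * (1/4)))" if "t > z"
      using that by (simp add: exp_add[symmetric])
    from mult_left_mono[OF this, of "t powr (s - 1)"]
    show "indicator {z<..} t * (t powr (s - 1) * exp (- t)) \<le> exp (- 3 * z / 4) * ?f t"
      using assms by (auto simp: mult_ac split: split_indicator)
  qed (use * has_bochner_integral_upper_Gamma[of z s] assms in \<open>auto simp: has_bochner_integral_iff\<close>)
  also have "\<dots> = exp (- 3 * z / 4) * ((1 / 4) powr (- s) * upper_Gamma s (z0 / 4))"
    using * by (simp add: has_bochner_integral_iff)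
  finally show ?thesis by (simp add: mult_ac)
qed

text \<open>With a > 0 and p > 1 the integrand is continuous on the compact interval from a to x,
  the end s = x included.\<close>

lemma integrable_powr_convolution:
  assumes "a > 0" "p > 1"
  shows "integrable lborel (\<lambda>s. indicator {a<..<x} s * (s powr (- k) * (x - s) powr (p - 1 :: real)))"
proof -
  have "set_integrable lborel {a..x} (\<lambda>s. s powr (- k) * (x - s) powr (p - 1))"
    by (rule borel_integrable_atLeastAtMost') (use assms in \<open>auto intro!: continuous_intros continuous_on_powr'\<close>)
  then have "set_integrable lborel {a<..<x} (\<lambda>s. s powr (- k) * (x - s) powr (p - 1))"
    by (rule set_integrable_subset) auto
  then show ?thesis by (simp add: set_integrable_def)
qed

text \<open>With X = x + n the powers of X collect to X^rho = x^rho (1 + n / x)^rho, the prefactor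
  of \<open>g_fun\<close>. The restriction n <= x keeps the lower limit 2 n / (x + n) at most 1, so
  the interval integral has no sign change. For n > x the range of s is empty, which is how the sum
  over n <= x becomes a full series.\<close>

lemma g_fun_eq:
  assumes "n \<ge> 1" "real n \<le> x"
  shows "of_real (x powr \<rho>) / (2 * of_real pi * \<i>) * g_fun k \<rho> n x =
    of_real ((LBINT s. indicator {2 * real n<..<x + n} s * (s powr (- k) * (x + n - s) powr (k + \<rho> - 1)))
       / Gamma (k + \<rho>))"
proof -
  define X where "X = x + n"
  have X: "X > 0" "x > 0" "2 * real n \<le> X" using assms by (auto simp: X_def)
  let ?h = "\<lambda>t. indicator {2 * real n / X<..<1} t * (t powr (- k) * (1 - t) powr (k + \<rho> - 1))"
  have "(LBINT s. indicator {2 * real n<..<X} s * (s powr (- k) * (X - s) powr (k + \<rho> - 1))) =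
    X * (LBINT t. indicator {2 * real n<..<X} (0 + X * t) * ((0 + X * t) powr (- k) * (X - (0 + X * t)) powr (k + \<rho> - 1)))"
    using X by (subst lborel_integral_real_affine[where c=X and t=0]) auto
  also have "(\<lambda>t. indicator {2 * real n<..<X} (0 + X * t) * ((0 + X * t) powr (- k) * (X - (0 + X * t)) powr (k + \<rho> - 1))) =
     (\<lambda>t. X powr (\<rho> - 1) * ?h t)"
  proof
    fix t
    have "(X * t) powr (- k) * (X - X * t) powr (k + \<rho> - 1) =
       X powr (\<rho> - 1) * (t powr (- k) * (1 - t) powr (k + \<rho> - 1))" if "0 < t" "t < 1"
    proof -
      have "X - X * t = X * (1 - t)" by (simp add: algebra_simps)
      then have "(X * t) powr (- k) * (X - X * t) powr (k + \<rho> - 1) =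
         (X powr (- k) * X powr (k + \<rho> - 1)) * (t powr (- k) * (1 - t) powr (k + \<rho> - 1))"
        using X that by (simp add: powr_mult)
      then show ?thesis by (simp add: powr_add[symmetric])
    qed
    moreover have "indicator {2 * real n<..<X} (0 + X * t) = (indicator {2 * real n / X<..<1} t :: real)"
      using X by (auto simp: field_simps split: split_indicator)
    moreover have "t > 0" if "2 * real n / X < t"
      using that X assms by (meson divide_nonneg_pos less_le_trans not_le of_nat_0_le_iff mult_nonneg_nonneg order.strict_trans1 zero_le_numeral)
    ultimately show "indicator {2 * real n<..<X} (0 + X * t) * ((0 + X * t) powr (- k) * (X - (0 + X * t)) powr (k + \<rho> - 1)) =
       X powr (\<rho> - 1) * ?h t"
      by (simp split: split_indicator)
  qed
  finally have 0: "(LBINT s. indicator {2 * real n<..<X} s * (s powr (- k) * (X - s) powr (k + \<rho> - 1))) =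
    X * (LBINT t. X powr (\<rho> - 1) * ?h t)" .
  have 1: "(LBINT s. indicator {2 * real n<..<X} s * (s powr (- k) * (X - s) powr (k + \<rho> - 1))) =
    X powr \<rho> * (LBINT t. ?h t)"
  proof -
    have "X * X powr (\<rho> - 1) = X powr \<rho>" using X by (simp add: powr_diff)
    then show ?thesis unfolding 0 by (subst integral_mult_right_zero) (simp only: mult.assoc[symmetric])
  qed
  have "2 * real n / X \<le> 1" using X by simp
  then have 2: "(LBINT t=ereal (2 * real n / X)..1. t powr (- k) * (1 - t) powr (k + \<rho> - 1)) = (LBINT t. ?h t)"
    by (simp add: interval_lebesgue_integral_def set_lebesgue_integral_def einterval_eq(1) one_ereal_def)
  have "x powr \<rho> * (1 + real n / x) powr \<rho> = X powr \<rho>"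
  proof -
    have "x powr \<rho> * (1 + real n / x) powr \<rho> = (x * (1 + real n / x)) powr \<rho>"
      using X by (subst powr_mult) auto
    also have "x * (1 + real n / x) = X" using X by (simp add: X_def field_simps)
    finally show ?thesis .
  qed
  then have 3: "of_real (x powr \<rho>) * of_real ((1 + real n / x) powr \<rho>) = (of_real (X powr \<rho>) :: complex)"
    by (metis of_real_mult)
  show ?thesis
    unfolding X_def[symmetric] 1 g_fun_def 2 of_real_mult of_real_divide 3[symmetric]
    by (simp add: field_simps)
qed

text \<open>The integral is the convolution of s^(-k) on s > 2 n with s^(k+rho-1), evaluated at x +
  n. It vanishes up to 2 n, so the advance by n loses nothing. The powers y^(k-1) and y^(-k-rho)
  combine to y^(-rho-1), and Gamma(k + rho) cancels.\<close>

lemma has_laplace_g_fun: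
  assumes "n \<ge> 1" "k + \<rho> > 1" "y > 0"
  shows "has_laplace (\<lambda>x. (LBINT s. indicator {2 * real n<..<x + n} s * (s powr (- k) * (x + n - s) powr (k + \<rho> - 1)))
       / Gamma (k + \<rho>)) y (y powr (- \<rho> - 1) * (exp (real n * y) * upper_Gamma (1 - k) (2 * real n * y)))"
proof -
  let ?f = "\<lambda>x. indicator {2 * real n<..} x * x powr ((1 - k) - 1)"
  let ?g = "\<lambda>x::real. x powr (k + \<rho> - 1)"
  define C where "C = (\<lambda>x. LBINT s. indicator {2 * real n<..<x} s * (s powr (- k) * (x - s) powr (k + \<rho> - 1)))"
  have G: "Gamma (k + \<rho>) > 0" using assms by simp
  have eq: "(\<lambda>s. indicator {0<..<x} s * (?f s * ?g (x - s))) =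
      (\<lambda>s. indicator {2 * real n<..<x} s * (s powr (- k) * (x - s) powr (k + \<rho> - 1)))" for x
    by (auto split: split_indicator)
  have "has_laplace (\<lambda>x. LBINT s. indicator {0<..<x} s * (?f s * ?g (x - s))) y
      ((y powr (- (1 - k)) * upper_Gamma (1 - k) (2 * real n * y)) * (Gamma (k + \<rho> - 1 + 1) * y powr (- (k + \<rho> - 1) - 1)))"
    using assms
    by (intro has_laplace_convolution has_laplace_powr_above has_laplace_powr; (unfold eq)?)
       (auto intro!: integrable_powr_convolution)
  then have "has_laplace C y
      (upper_Gamma (1 - k) (2 * real n * y) * Gamma (k + \<rho>) * (y powr (k - 1) * y powr (- k - \<rho>)))"
    unfolding eq C_def[symmetric] by (simp add: mult_ac)
  also have "y powr (k - 1) * y powr (- k - \<rho>) = y powr (- \<rho> - 1)"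
  proof -
    have "(k - 1) + (- k - \<rho>) = - \<rho> - 1" by simp
    then show ?thesis by (metis powr_add)
  qed
  finally have "has_laplace (\<lambda>x. C (x + n)) y (exp (n * y) *
      (upper_Gamma (1 - k) (2 * real n * y) * Gamma (k + \<rho>) * y powr (- \<rho> - 1)))"
    by (rule has_laplace_translate) (auto simp: C_def)
  then have "has_laplace (\<lambda>x. 1 / Gamma (k + \<rho>) * C (x + n)) y (1 / Gamma (k + \<rho>) * (exp (n * y) *
      (upper_Gamma (1 - k) (2 * real n * y) * Gamma (k + \<rho>) * y powr (- \<rho> - 1))))"
    by (rule has_laplace_mult)
  then show ?thesis using G by (simp add: C_def mult_ac)
qed

subsection \<open>Bessel functions\<close>

text \<open>Each unit shift divides the reciprocal Gamma function by its argument, which is at least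
  1 here.\<close>

lemma rGamma_shift_le:
  assumes "\<nu> \<ge> (0::real)"
  shows "0 \<le> rGamma (real m + \<nu> + 1)" "rGamma (real m + \<nu> + 1) \<le> rGamma (\<nu> + 1)"
proof -
  show nn: "0 \<le> rGamma (real m + \<nu> + 1)" for m
    using assms Gamma_real_pos[of "real m + \<nu> + 1"] by (simp add: rGamma_inverse_Gamma)
  show "rGamma (real m + \<nu> + 1) \<le> rGamma (\<nu> + 1)"
  proof (induction m)
    case (Suc m)
    have "rGamma (real (Suc m) + \<nu> + 1) = 1 * rGamma (real (Suc m) + \<nu> + 1)" by simp
    also have "\<dots> \<le> (real m + \<nu> + 1) * rGamma (real (Suc m) + \<nu> + 1)"
      by (intro mult_right_mono nn) (use assms in auto)
    also have "\<dots> = rGamma (real m + \<nu> + 1)"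
      using rGamma_plus1[of "real m + \<nu> + 1"] by (simp add: algebra_simps)
    finally show ?case using Suc by simp
  qed simp
qed

definition bessel_coeff :: "real \<Rightarrow> nat \<Rightarrow> real" where
  "bessel_coeff \<nu> m = (-1) ^ m / fact m * rGamma (real m + \<nu> + 1)"

text \<open>Coefficient form of z h'' + (nu + 1) h' + h = 0.\<close>

lemma bessel_coeff_Suc:
  "(real m + 1) * (real m + \<nu> + 1) * bessel_coeff \<nu> (Suc m) = - bessel_coeff \<nu> m"
proof -
  have G: "rGamma (real m + \<nu> + 1) = (real m + \<nu> + 1) * rGamma (real (Suc m) + \<nu> + 1)"
    using rGamma_plus1[of "real m + \<nu> + 1"] by (simp add: algebra_simps)
  have f: "(real m + 1) * ((-1) ^ Suc m / fact (Suc m)) = - ((-1) ^ m / fact m :: real)"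
    by (simp add: divide_simps)
  have "(real m + 1) * (real m + \<nu> + 1) * bessel_coeff \<nu> (Suc m) =
      ((real m + 1) * ((-1) ^ Suc m / fact (Suc m))) * ((real m + \<nu> + 1) * rGamma (real (Suc m) + \<nu> + 1))"
    unfolding bessel_coeff_def by (simp only: mult_ac)
  also have "\<dots> = - bessel_coeff \<nu> m"
    unfolding f G[symmetric] bessel_coeff_def by simp
  finally show ?thesis .
qed

lemma abs_bessel_coeff_le: "\<nu> \<ge> 0 \<Longrightarrow> \<bar>bessel_coeff \<nu> m\<bar> \<le> rGamma (\<nu> + 1) / fact m"
  using rGamma_shift_le[of \<nu> m] by (simp add: bessel_coeff_def abs_mult divide_right_mono)

lemma summable_abs_bessel_coeff:
  assumes "\<nu> \<ge> 0"
  shows "summable (\<lambda>m. \<bar>bessel_coeff \<nu> m\<bar> * \<bar>z\<bar> ^ m)"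
proof (rule summable_comparison_test'[of _ 0])
  show "summable (\<lambda>m. rGamma (\<nu> + 1) * (\<bar>z\<bar> ^ m / fact m))"
    using summable_exp[of "\<bar>z\<bar>"] by (intro summable_mult) (simp add: field_simps)
  show "norm (\<bar>bessel_coeff \<nu> m\<bar> * \<bar>z\<bar> ^ m) \<le> rGamma (\<nu> + 1) * (\<bar>z\<bar> ^ m / fact m)" for m
    using mult_right_mono[OF abs_bessel_coeff_le[OF assms, of m], of "\<bar>z\<bar> ^ m"] by simp
qed

lemma summable_bessel_coeff:
  fixes z :: real
  assumes "\<nu> \<ge> 0"
  shows "summable (\<lambda>m. bessel_coeff \<nu> m * z ^ m)"
  by (rule summable_norm_cancel) (use summable_abs_bessel_coeff[OF assms, of z] in \<open>simp add: abs_mult power_abs\<close>)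

text \<open>The entire factor of the Bessel function in the variable z = (x / 2)^2, that is, the
  Bessel-Clifford function of order nu at - z. The only nonanalytic factor of J is then (x /
  2)^nu.\<close>

definition bessel_series :: "real \<Rightarrow> real \<Rightarrow> real" where
  "bessel_series \<nu> z = (\<Sum>m. bessel_coeff \<nu> m * z ^ m)"

lemma bessel_J_eq:
  assumes "\<nu> \<ge> 0" "x > 0"
  shows "bessel_J \<nu> x = (x / 2) powr \<nu> * bessel_series \<nu> ((x / 2)\<^sup>2)"
proof -
  have "(x / 2) powr (2 * real m + \<nu>) = (x / 2) powr \<nu> * ((x / 2)\<^sup>2) ^ m" for m
    using powr_realpow[of "x / 2" "2 * m"] assms(2) by (simp add: powr_add power_mult)
  then have "bessel_J \<nu> x = (\<Sum>m. (x / 2) powr \<nu> * (bessel_coeff \<nu> m * ((x / 2)\<^sup>2) ^ m))"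
    unfolding bessel_J_def bessel_coeff_def by (simp add: mult_ac)
  also have "\<dots> = (x / 2) powr \<nu> * bessel_series \<nu> ((x / 2)\<^sup>2)"
    unfolding bessel_series_def by (intro suminf_mult summable_bessel_coeff assms)
  finally show ?thesis .
qed

text \<open>This is Bessel's equation in the variable z = (x / 2)^2, reduced by comparing
  coefficients to \<open>bessel_coeff_Suc\<close>.\<close>

lemma bessel_series_deriv:
  assumes "\<nu> \<ge> 0"
  obtains h1 h2 where
    "\<And>z. (bessel_series \<nu> has_field_derivative h1 z) (at z)"
    "\<And>z. (h1 has_field_derivative h2 z) (at z)"
    "\<And>z. z * h2 z + (\<nu> + 1) * h1 z + bessel_series \<nu> z = 0"
proof -
  let ?c = "bessel_coeff \<nu>"
  define h1 where "h1 = (\<lambda>z. \<Sum>m. diffs ?c m * z ^ m)"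
  define h2 where "h2 = (\<lambda>z. \<Sum>m. diffs (diffs ?c) m * z ^ m)"
  have s0: "summable (\<lambda>m. ?c m * z ^ m)" for z by (rule summable_bessel_coeff[OF assms])
  have s1: "summable (\<lambda>m. diffs ?c m * z ^ m)" for z by (rule termdiff_converges_all[OF s0])
  have s2: "summable (\<lambda>m. diffs (diffs ?c) m * z ^ m)" for z by (rule termdiff_converges_all[OF s1])
  have "z * h2 z + (\<nu> + 1) * h1 z + bessel_series \<nu> z = 0" for z
  proof -
    have "(\<lambda>m. z * (diffs (diffs ?c) m * z ^ m)) sums (z * h2 z)"
      unfolding h2_def by (intro sums_mult summable_sums s2)
    also have "(\<lambda>m. z * (diffs (diffs ?c) m * z ^ m)) = (\<lambda>m. real (Suc m) * diffs ?c (Suc m) * z ^ Suc m)"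
      by (auto simp: diffs_def)
    \<comment> \<open>The shift of index is free, because the new term at m = 0 carries the factor
      0.\<close>
    finally have "(\<lambda>m. real m * diffs ?c m * z ^ m) sums (z * h2 z)"
      by (subst (asm) sums_Suc_iff) simp
    moreover have "(\<lambda>m. (\<nu> + 1) * (diffs ?c m * z ^ m)) sums ((\<nu> + 1) * h1 z)"
      unfolding h1_def by (intro sums_mult summable_sums s1)
    moreover have "(\<lambda>m. ?c m * z ^ m) sums bessel_series \<nu> z"
      unfolding bessel_series_def by (intro summable_sums s0)
    ultimately have "(\<lambda>m. real m * diffs ?c m * z ^ m + (\<nu> + 1) * (diffs ?c m * z ^ m) + ?c m * z ^ m) sums
        (z * h2 z + (\<nu> + 1) * h1 z + bessel_series \<nu> z)"
      by (intro sums_add)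
    moreover have "real m * diffs ?c m * z ^ m + (\<nu> + 1) * (diffs ?c m * z ^ m) + ?c m * z ^ m =
        ((real m + 1) * (real m + \<nu> + 1) * ?c (Suc m) + ?c m) * z ^ m" for m
      by (simp add: diffs_def algebra_simps)
    ultimately show ?thesis
      using sums_unique2[of "\<lambda>_. 0::real"] by (simp add: bessel_coeff_Suc)
  qed
  moreover have "(bessel_series \<nu> has_field_derivative h1 z) (at z)" for z
    unfolding h1_def bessel_series_def[abs_def] by (rule termdiffs_strong_converges_everywhere[OF s0])
  moreover have "(h1 has_field_derivative h2 z) (at z)" for z
    unfolding h1_def h2_def by (rule termdiffs_strong_converges_everywhere[OF s1])
  ultimately show ?thesis using that by blast
qed

text \<open>For \<open>x \<ge> 1\<close>, Bessel's equation gives \<open>E' \<le> (\<nu>\<^sup>2 / x\<^sup>2) E\<close> for the energy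
  \<open>E = J\<^sup>2 + J'\<^sup>2\<close>, so \<open>exp (\<nu>\<^sup>2 / x) E\<close> decreases.\<close>

lemma bessel_J_bounded:
  assumes "\<nu> \<ge> 0"
  obtains C where "C \<ge> 0" "\<And>x. x > 0 \<Longrightarrow> \<bar>bessel_J \<nu> x\<bar> \<le> C"
proof -
  obtain h1 h2 where
    d0: "\<And>z. (bessel_series \<nu> has_field_derivative h1 z) (at z)" and
    d1: "\<And>z. (h1 has_field_derivative h2 z) (at z)" and
    ode: "\<And>z. z * h2 z + (\<nu> + 1) * h1 z + bessel_series \<nu> z = 0"
    using bessel_series_deriv[OF assms] by metis
  let ?h = "bessel_series \<nu>"
  define J where "J = (\<lambda>x. (x / 2) powr \<nu> * ?h ((x / 2)\<^sup>2))"
  \<comment> \<open>\<open>r\<close> is the derivative J', written out in terms of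
    \<open>h1\<close>.\<close>
  define r where "r = (\<lambda>x. (x / 2) powr \<nu> * (\<nu> / x * ?h ((x / 2)\<^sup>2) + x / 2 * h1 ((x / 2)\<^sup>2)))"
  have dJ: "(J has_field_derivative r x) (at x)" if "x > 0" for x
    unfolding J_def r_def using that
    by (auto intro!: derivative_eq_intros DERIV_chain2[OF d0] simp: powr_diff field_simps power2_eq_square)
  \<comment> \<open>Bessel's equation, with \<open>r\<close> in the role of J'.\<close>
  have dr: "(r has_field_derivative (\<nu>\<^sup>2 / x\<^sup>2 - 1) * J x - r x / x) (at x)" if "x > 0" for x
  proof -
    define H where "H = ?h ((x / 2)\<^sup>2)"
    define H1 where "H1 = h1 ((x / 2)\<^sup>2)"
    define H2 where "H2 = h2 ((x / 2)\<^sup>2)"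
    define T where "T = (x / 2) powr \<nu>"
    have o: "x\<^sup>2 * H2 = - 4 * (\<nu> + 1) * H1 - 4 * H"
      using ode[of "(x/2)\<^sup>2"] unfolding H_def H1_def H2_def by (simp add: field_simps)
    have "(r has_field_derivative
        (\<nu> * T / x) * (\<nu> / x * H + x / 2 * H1) +
        T * (- \<nu> / x\<^sup>2 * H + \<nu> / x * (H1 * (x / 2)) + 1 / 2 * H1 + x / 2 * (H2 * (x / 2)))) (at x)"
      unfolding r_def H_def H1_def H2_def T_def using that
      by (auto intro!: derivative_eq_intros DERIV_chain2[OF d0] DERIV_chain2[OF d1] simp: powr_diff)
         (simp add: field_simps power2_eq_square)
    also have "(\<nu> * T / x) * (\<nu> / x * H + x / 2 * H1) +
        T * (- \<nu> / x\<^sup>2 * H + \<nu> / x * (H1 * (x / 2)) + 1 / 2 * H1 + x / 2 * (H2 * (x / 2))) =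
        (\<nu> * T / x) * (\<nu> / x * H + x / 2 * H1) +
        T * (- \<nu> / x\<^sup>2 * H + \<nu> / x * (H1 * (x / 2)) + 1 / 2 * H1 + (x\<^sup>2 * H2) / 4)"
      by (simp add: power2_eq_square)
    also have "\<dots> = (\<nu>\<^sup>2 / x\<^sup>2 - 1) * (T * H) - T * (\<nu> / x * H + x / 2 * H1) / x"
      unfolding o using that by (simp add: field_simps power2_eq_square)
    finally show ?thesis unfolding J_def r_def H_def H1_def T_def .
  qed
  define E where "E = (\<lambda>x. exp (\<nu>\<^sup>2 / x) * ((J x)\<^sup>2 + (r x)\<^sup>2))"
  have E: "E b \<le> E 1" if "b \<ge> 1" for b
  proof (rule DERIV_nonpos_imp_nonincreasing[OF that])
    fix x :: real assume "1 \<le> x" "x \<le> b"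
    then have x: "x > 0" by simp
    define D where "D = exp (\<nu>\<^sup>2 / x) * (- \<nu>\<^sup>2 / x\<^sup>2 * ((J x)\<^sup>2 + (r x)\<^sup>2) +
       (2 * J x * r x + 2 * r x * ((\<nu>\<^sup>2 / x\<^sup>2 - 1) * J x - r x / x)))"
    have "(E has_field_derivative D) (at x)"
      unfolding E_def D_def using x
      by (auto intro!: derivative_eq_intros dJ dr simp: algebra_simps power2_eq_square)
    moreover have "D \<le> 0"
    proof -
      \<comment> \<open>The terms 2 J J' without nu cancel; the one with nu^2 / x^2 completes a
        square, and the damping term - J' / x contributes a second nonpositive summand.\<close>
      have "- \<nu>\<^sup>2 / x\<^sup>2 * ((J x)\<^sup>2 + (r x)\<^sup>2) + (2 * J x * r x + 2 * r x * ((\<nu>\<^sup>2 / x\<^sup>2 - 1) * J x - r x / x))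
         = - (\<nu>\<^sup>2 / x\<^sup>2 * (J x - r x)\<^sup>2) - 2 * (r x)\<^sup>2 / x"
        using x by (simp add: field_simps power2_eq_square)
      also have "\<dots> \<le> 0 - 0" using x by (intro diff_mono) auto
      also have "\<dots> = (0::real)" by simp
      finally show ?thesis unfolding D_def by (intro mult_nonneg_nonpos) auto
    qed
    ultimately show "\<exists>d. (E has_field_derivative d) (at x) \<and> d \<le> 0" by blast
  qed
  \<comment> \<open>Below 1 the weight exp (nu^2 / x) can blow up, so the energy does not help.
    There (x / 2)^nu is at most 1 and the entire factor is bounded on a compact set.\<close>
  have "continuous_on {0..1} ?h"
    by (meson d0 DERIV_isCont continuous_at_imp_continuous_on)
  then have "bounded (?h ` {0..1})"
    by (intro compact_imp_bounded compact_continuous_image) auto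
  then obtain B where B: "\<And>z. z \<in> {0..1} \<Longrightarrow> \<bar>?h z\<bar> \<le> B"
    unfolding bounded_iff real_norm_def by blast
  have "\<bar>bessel_J \<nu> x\<bar> \<le> max B (sqrt (E 1))" if x: "x > 0" for x
  proof (cases "x \<ge> 1")
    case True
    have "(J x)\<^sup>2 \<le> 1 * ((J x)\<^sup>2 + (r x)\<^sup>2)" by simp
    also have "\<dots> \<le> E x" unfolding E_def using x by (intro mult_right_mono) auto
    also have "\<dots> \<le> E 1" by (rule E[OF True])
    finally have "\<bar>J x\<bar> \<le> sqrt (E 1)" by (metis real_sqrt_abs real_sqrt_le_iff)
    then show ?thesis using bessel_J_eq[OF assms x] unfolding J_def by simp
  next
    case False
    then have "(x / 2)\<^sup>2 \<in> {0..1}" using x by (auto simp: power_le_one)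
    then have "\<bar>?h ((x / 2)\<^sup>2)\<bar> \<le> B" by (rule B)
    moreover have "(x / 2) powr \<nu> \<le> 1" using False x assms by (intro powr_le1) auto
    ultimately have "(x / 2) powr \<nu> * \<bar>?h ((x / 2)\<^sup>2)\<bar> \<le> 1 * B"
      by (intro mult_mono) auto
    then show ?thesis using bessel_J_eq[OF assms x] by (simp add: abs_mult)
  qed
  moreover have "max B (sqrt (E 1)) \<ge> 0" unfolding E_def by (simp add: le_max_iff_disj)
  ultimately show ?thesis using that by blast
qed

lemma bessel_J_measurable [measurable]: "bessel_J \<nu> \<in> borel_measurable borel"
  unfolding bessel_J_def[abs_def] by measurable

text \<open>Transform the power series term by term: Gamma(m + nu + 1) coming from x^(m+nu) cancels
  the reciprocal Gamma of the coefficient and leaves (- a / y)^m / m!. The same computation with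
  absolute values gives (a / y)^m / m!, a summable majorant.\<close>

lemma has_laplace_bessel_J:
  assumes "\<nu> \<ge> 0" "a > 0" "y > 0"
  shows "has_laplace (\<lambda>x. x powr (\<nu> / 2) * bessel_J \<nu> (2 * sqrt (a * x))) y
           (a powr (\<nu> / 2) * (y powr (- \<nu> - 1) * exp (- a / y)))"
proof -
  let ?f = "\<lambda>m x. (a powr (\<nu> / 2) * a ^ m * bessel_coeff \<nu> m) * x powr (real m + \<nu>)"
  let ?g = "\<lambda>m x. (a powr (\<nu> / 2) * a ^ m * \<bar>bessel_coeff \<nu> m\<bar>) * x powr (real m + \<nu>)"
  have G: "bessel_coeff \<nu> m * Gamma (real m + \<nu> + 1) = (-1) ^ m / fact m" for m
    using assms Gamma_real_pos[of "real m + \<nu> + 1"]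
    by (simp add: bessel_coeff_def rGamma_inverse_Gamma del: Gamma_real_pos)
  have pw: "x powr (real m + \<nu>) = x powr \<nu> * x ^ m" if "x > 0" for x :: real and m
    using that by (simp add: powr_add powr_realpow)
  have L: "has_laplace (\<lambda>x. x powr (real m + \<nu>)) y (Gamma (real m + \<nu> + 1) * y powr (- (real m + \<nu>) - 1))" for m
    by (rule has_laplace_powr) (use assms in auto)
  have ye: "y powr (- (real m + \<nu>) - 1) = y powr (- \<nu> - 1) / y ^ m" for m
  proof -
    have "- (real m + \<nu>) - 1 = (- \<nu> - 1) - real m" by simp
    then show ?thesis using assms by (simp only: powr_diff powr_realpow)
  qed
  have "has_laplace (?f m) y ((a powr (\<nu> / 2) * a ^ m * bessel_coeff \<nu> m) *
       (Gamma (real m + \<nu> + 1) * y powr (- (real m + \<nu>) - 1)))" for m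
    by (rule has_laplace_mult[OF L])
  also have "(a powr (\<nu> / 2) * a ^ m * bessel_coeff \<nu> m) * (Gamma (real m + \<nu> + 1) * y powr (- (real m + \<nu>) - 1)) =
      a powr (\<nu> / 2) * y powr (- \<nu> - 1) * ((- a / y) ^ m /\<^sub>R fact m)" for m
  proof -
    have "(a powr (\<nu> / 2) * a ^ m * bessel_coeff \<nu> m) * (Gamma (real m + \<nu> + 1) * y powr (- (real m + \<nu>) - 1)) =
      a powr (\<nu> / 2) * a ^ m * (bessel_coeff \<nu> m * Gamma (real m + \<nu> + 1)) * (y powr (- \<nu> - 1) / y ^ m)"
      unfolding ye by (simp add: mult_ac)
    also have "\<dots> = a powr (\<nu> / 2) * y powr (- \<nu> - 1) * ((- a / y) ^ m /\<^sub>R fact m)"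
      unfolding G by (simp add: power_divide power_minus[of "a / y"] field_simps)
    finally show ?thesis .
  qed
  finally have f: "has_laplace (?f m) y (a powr (\<nu> / 2) * y powr (- \<nu> - 1) * ((- a / y) ^ m /\<^sub>R fact m))" for m .
  have "has_laplace (?g m) y ((a powr (\<nu> / 2) * a ^ m * \<bar>bessel_coeff \<nu> m\<bar>) *
       (Gamma (real m + \<nu> + 1) * y powr (- (real m + \<nu>) - 1)))" for m
    by (rule has_laplace_mult[OF L])
  also have "(a powr (\<nu> / 2) * a ^ m * \<bar>bessel_coeff \<nu> m\<bar>) * (Gamma (real m + \<nu> + 1) * y powr (- (real m + \<nu>) - 1)) =
      a powr (\<nu> / 2) * y powr (- \<nu> - 1) * ((a / y) ^ m /\<^sub>R fact m)" for m
  proof -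
    have G': "\<bar>bessel_coeff \<nu> m\<bar> * Gamma (real m + \<nu> + 1) = 1 / fact m"
      using arg_cong[OF G[of m], of abs] assms Gamma_real_pos[of "real m + \<nu> + 1"]
      by (simp add: abs_mult)
    have "(a powr (\<nu> / 2) * a ^ m * \<bar>bessel_coeff \<nu> m\<bar>) * (Gamma (real m + \<nu> + 1) * y powr (- (real m + \<nu>) - 1)) =
      a powr (\<nu> / 2) * a ^ m * (\<bar>bessel_coeff \<nu> m\<bar> * Gamma (real m + \<nu> + 1)) * (y powr (- \<nu> - 1) / y ^ m)"
      unfolding ye by (simp add: mult_ac)
    also have "\<dots> = a powr (\<nu> / 2) * y powr (- \<nu> - 1) * ((a / y) ^ m /\<^sub>R fact m)"
      unfolding G' by (simp add: power_divide field_simps)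
    finally show ?thesis .
  qed
  finally have g: "has_laplace (?g m) y (a powr (\<nu> / 2) * y powr (- \<nu> - 1) * ((a / y) ^ m /\<^sub>R fact m))" for m .
  have sg: "summable (\<lambda>m. ?g m x)" if "x > 0" for x
  proof -
    have "summable (\<lambda>m. (a powr (\<nu> / 2) * x powr \<nu>) * (\<bar>bessel_coeff \<nu> m\<bar> * \<bar>a * x\<bar> ^ m))"
      by (intro summable_mult summable_abs_bessel_coeff assms)
    then show ?thesis using that assms by (simp add: pw power_mult_distrib mult_ac abs_mult)
  qed
  have "has_laplace (\<lambda>x. \<Sum>m. ?f m x) y (\<Sum>m. a powr (\<nu> / 2) * y powr (- \<nu> - 1) * ((- a / y) ^ m /\<^sub>R fact m))"
  proof (rule has_laplace_suminf(1)[OF f g _ sg])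
    show "norm (?f m x) \<le> ?g m x" if "x > 0" for m x
      using assms by (simp add: abs_mult)
    show "summable (\<lambda>m. a powr (\<nu> / 2) * y powr (- \<nu> - 1) * ((a / y) ^ m /\<^sub>R fact m))"
      by (intro summable_mult summable_exp_generic)
  qed
  also have "(\<Sum>m. a powr (\<nu> / 2) * y powr (- \<nu> - 1) * ((- a / y) ^ m /\<^sub>R fact m)) =
      a powr (\<nu> / 2) * (y powr (- \<nu> - 1) * exp (- a / y))"
    unfolding exp_def by (subst suminf_mult[OF summable_exp_generic]) (simp add: mult.assoc)
  finally show ?thesis
  proof (rule has_laplace_cong[THEN iffD1, rotated -1])
    fix x :: real assume x: "x > 0"
    have "bessel_J \<nu> (2 * sqrt (a * x)) = (sqrt (a * x)) powr \<nu> * bessel_series \<nu> (a * x)"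
      using assms x by (subst bessel_J_eq) auto
    also have "(sqrt (a * x)) powr \<nu> = a powr (\<nu> / 2) * x powr (\<nu> / 2)"
      using assms x by (simp add: powr_half_sqrt[symmetric] powr_powr powr_mult)
    finally have "x powr (\<nu> / 2) * bessel_J \<nu> (2 * sqrt (a * x)) =
        (a powr (\<nu> / 2) * (x powr (\<nu> / 2) * x powr (\<nu> / 2))) * bessel_series \<nu> (a * x)"
      by (simp add: mult_ac)
    also have "x powr (\<nu> / 2) * x powr (\<nu> / 2) = x powr \<nu>" by (simp add: powr_add[symmetric])
    also have "(a powr (\<nu> / 2) * x powr \<nu>) * bessel_series \<nu> (a * x) =
        (\<Sum>m. (a powr (\<nu> / 2) * x powr \<nu>) * (bessel_coeff \<nu> m * (a * x) ^ m))"
      unfolding bessel_series_def by (intro suminf_mult[symmetric] summable_bessel_coeff assms)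
    also have "\<dots> = (\<Sum>m. ?f m x)"
      by (simp add: pw[OF x] power_mult_distrib mult_ac)
    finally show "(\<Sum>m. ?f m x) = x powr (\<nu> / 2) * bessel_J \<nu> (2 * sqrt (a * x))" ..
  qed simp
qed

subsection \<open>The Bessel kernel\<close>

text \<open>Under u = A / t the exponent becomes A - t, the measure u^(k-2) du becomes A^(k-1)
  t^(-k) dt, and u < 1/2 becomes t > 2 A.\<close>

lemma has_bochner_integral_exp_reciprocal:
  assumes "A > 0"
  shows "has_bochner_integral lborel
      (\<lambda>u. indicator {0<..<1/2} u * (u powr (k - 2) * exp (- (A * (1 - u) / u))))
      (exp A * A powr (k - 1) * upper_Gamma (1 - k) (2 * A))"
proof -
  let ?f = "\<lambda>u. u powr (k - 2) * exp (- (A * (1 - u) / u))"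
  let ?h = "\<lambda>t. t powr ((1 - k) - 1) * exp (- t)"
  have hb: "has_bochner_integral lborel (\<lambda>t. indicator {2 * A<..} t * ?h t) (upper_Gamma (1 - k) (2 * A))"
    by (rule has_bochner_integral_upper_Gamma) (use assms in simp)
  have si: "set_integrable lborel {2 * A<..} ?h"
    using hb by (simp add: has_bochner_integral_iff set_integrable_def)
  have hi: "integral {2 * A<..} ?h = upper_Gamma (1 - k) (2 * A)"
    using set_borel_integral_eq_integral(2)[OF si] hb
    by (simp add: has_bochner_integral_iff set_lebesgue_integral_def)
  \<comment> \<open>The change of variables is stated for absolute integrability over the completed
    measure, hence the passage from \<open>lborel\<close> here and back at the end.\<close>
  have ai: "?h absolutely_integrable_on {2 * A<..}"
    using si unfolding set_integrable_def by (subst integrable_completion) auto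
  have eq: "\<bar>- A / t\<^sup>2\<bar> * ?f (A / t) = exp A * A powr (k - 1) * ?h t" if "t \<in> {2 * A<..}" for t
  proof -
    have t: "t > 0" using that assms by (auto intro: less_trans[of 0 "2 * A"])
    have "- (A * (1 - A / t) / (A / t)) = A - t" using assms t by (simp add: field_simps)
    then have e: "exp (- (A * (1 - A / t) / (A / t))) = exp A * exp (- t)"
      by (simp add: exp_diff exp_minus divide_inverse)
    have "A powr (k - 2) = A powr (k - 1) / A" using powr_diff[of A "k - 1" 1] assms by simp
    moreover have "t powr (k - 2) = t powr k / t\<^sup>2" using t by (simp add: powr_diff)
    moreover have "t powr ((1 - k) - 1) = 1 / t powr k" by (simp add: powr_minus divide_inverse)
    ultimately show ?thesis
      unfolding e using assms t by (simp add: powr_divide abs_mult)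
  qed
  have im: "(\<lambda>t. A / t) ` {2 * A<..} = {0<..<1/2}"
  proof (intro equalityI subsetI)
    fix u assume "u \<in> (\<lambda>t. A / t) ` {2 * A<..}"
    then show "u \<in> {0<..<1/2}" using assms by (auto simp: field_simps intro!: divide_pos_pos)
  next
    fix u :: real assume "u \<in> {0<..<1/2}"
    then have "u = A / (A / u)" "A / u \<in> {2 * A<..}" using assms by (auto simp: field_simps)
    then show "u \<in> (\<lambda>t. A / t) ` {2 * A<..}" by blast
  qed
  have der: "((\<lambda>t. A / t) has_field_derivative - A / t\<^sup>2) (at t within {2 * A<..})" if "t \<in> {2 * A<..}" for t
    using that assms by (auto intro!: derivative_eq_intros simp: power2_eq_square)
  have inj: "inj_on (\<lambda>t. A / t) {2 * A<..}"
    using assms by (auto simp: inj_on_def)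
  let ?I = "exp A * A powr (k - 1) * upper_Gamma (1 - k) (2 * A)"
  have "(\<lambda>t. \<bar>- A / t\<^sup>2\<bar> * ?f (A / t)) absolutely_integrable_on {2 * A<..} \<and>
      integral {2 * A<..} (\<lambda>t. \<bar>- A / t\<^sup>2\<bar> * ?f (A / t)) = ?I"
  proof
    have "(\<lambda>t. exp A * A powr (k - 1) * ?h t) absolutely_integrable_on {2 * A<..}"
      by (rule set_integrable_mult_right) (rule ai)
    then show "(\<lambda>t. \<bar>- A / t\<^sup>2\<bar> * ?f (A / t)) absolutely_integrable_on {2 * A<..}"
      by (rule set_integrable_cong[THEN iffD1, rotated -1]) (use eq in auto)
    have "integral {2 * A<..} (\<lambda>t. \<bar>- A / t\<^sup>2\<bar> * ?f (A / t)) =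
        integral {2 * A<..} (\<lambda>t. exp A * A powr (k - 1) * ?h t)"
      by (rule integral_cong) (rule eq)
    then show "integral {2 * A<..} (\<lambda>t. \<bar>- A / t\<^sup>2\<bar> * ?f (A / t)) = ?I"
      unfolding integral_mult_right hi .
  qed
  moreover have "(\<lambda>t. \<bar>- A / t\<^sup>2\<bar> * ?f (A / t)) absolutely_integrable_on {2 * A<..} \<and>
      integral {2 * A<..} (\<lambda>t. \<bar>- A / t\<^sup>2\<bar> * ?f (A / t)) = ?I \<longleftrightarrow>
      ?f absolutely_integrable_on (\<lambda>t. A / t) ` {2 * A<..} \<and> integral ((\<lambda>t. A / t) ` {2 * A<..}) ?f = ?I"
    by (rule has_absolute_integral_change_of_variables_1'[OF _ der inj]) simp_all
  ultimately have "?f absolutely_integrable_on (\<lambda>t. A / t) ` {2 * A<..} \<and> integral ((\<lambda>t. A / t) ` {2 * A<..}) ?f = ?I"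
    by (rule iffD1[rotated])
  then have *: "?f absolutely_integrable_on {0<..<1/2}" "integral {0<..<1/2} ?f = ?I"
    unfolding im by simp_all
  have "set_integrable lborel {0<..<1/2} ?f"
    using *(1) unfolding set_integrable_def by (subst (asm) integrable_completion) auto
  then show ?thesis
    using set_borel_integral_eq_integral(2)[of "{0<..<1/2}" ?f] *(2)
    by (simp add: has_bochner_integral_iff set_integrable_def set_lebesgue_integral_def)
qed

text \<open>Fubini with a product majorant w(u) g(x); the continuous counterpart of the exchange
  with a series, needed for the u-integral.\<close>

lemma has_laplace_integral:
  fixes f :: "real \<Rightarrow> real \<Rightarrow> real"
  assumes [measurable]: "(\<lambda>(u, x). f u x) \<in> borel_measurable (borel \<Otimes>\<^sub>M borel)"
    and le: "\<And>u x. x > 0 \<Longrightarrow> \<bar>f u x\<bar> \<le> w u * g x"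
    and w: "integrable lborel w" and g: "has_laplace g y G"
    and f: "\<And>u. has_laplace (f u) y (F u)"
  shows "has_laplace (\<lambda>x. LBINT u. f u x) y (LBINT u. F u)"
proof -
  let ?e = "\<lambda>x. indicator {0<..} x * exp (- (x * y)) :: real"
  have ge: "integrable lborel (\<lambda>x. ?e x * g x)"
    using g by (simp add: has_laplace_def has_bochner_integral_iff)
  have [measurable]: "w \<in> borel_measurable borel" using w by auto
  have [measurable]: "(\<lambda>x. ?e x * g x) \<in> borel_measurable borel" using ge by auto
  have prod: "integrable (lborel \<Otimes>\<^sub>M lborel) (\<lambda>z. w (fst z) * (?e (snd z) * g (snd z)))"
  proof (rule lborel_pair.Fubini_integrable)
    show "(\<lambda>z. w (fst z) * (?e (snd z) * g (snd z))) \<in> borel_measurable (lborel \<Otimes>\<^sub>M lborel)"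
      by measurable
    show "integrable lborel (\<lambda>u. LBINT x. norm (w (fst (u, x)) * (?e (snd (u, x)) * g (snd (u, x)))))"
      using w by (simp add: abs_mult)
    show "AE u in lborel. integrable lborel (\<lambda>x. w (fst (u, x)) * (?e (snd (u, x)) * g (snd (u, x))))"
      using ge by simp
  qed
  have int: "integrable (lborel \<Otimes>\<^sub>M lborel) (\<lambda>(u, x). ?e x * f u x)"
  proof (rule Bochner_Integration.integrable_bound[OF prod])
    show "AE z in lborel \<Otimes>\<^sub>M lborel. norm (case z of (u, x) \<Rightarrow> ?e x * f u x)
        \<le> norm (w (fst z) * (?e (snd z) * g (snd z)))"
    proof (intro AE_I2)
      fix z :: "real \<times> real"
      show "norm (case z of (u, x) \<Rightarrow> ?e x * f u x) \<le> norm (w (fst z) * (?e (snd z) * g (snd z)))"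
        using mult_left_mono[OF order.trans[OF le[of "snd z" "fst z"] abs_ge_self], of "exp (- (snd z * y))"]
        by (auto simp: abs_mult mult_ac split: prod.splits split_indicator)
    qed
  qed measurable
  have eq: "(LBINT u. ?e x * f u x) = ?e x * (LBINT u. f u x)" for x
    by simp
  have F: "(LBINT x. ?e x * f u x) = F u" for u
    using f[of u] by (simp add: has_laplace_def has_bochner_integral_iff)
  show ?thesis
    unfolding has_laplace_def has_bochner_integral_iff
    using lborel_pair.integrable_snd[OF int] lborel_pair.Fubini_integral[OF int]
    by (simp add: F)
qed

text \<open>The u-integral attached to b^-(n), with c = n / N.\<close>

definition bessel_kernel :: "real \<Rightarrow> real \<Rightarrow> real \<Rightarrow> real \<Rightarrow> real" where
  "bessel_kernel k \<rho> c x =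
     (LBINT u=0..ereal (1/2). u powr (k + (\<rho> - 3) / 2) / (1 - u) powr ((1 + \<rho>) / 2) *
        bessel_J (\<rho> + 1) (4 * pi * sqrt (c * x * (1 - u) / u)))"

text \<open>The second assumption tames u = 0, so the integrand is bounded on (0, 1/2) by a constant
  independent of c and x. That constant both yields C, which later dominates all n at once, and
  supplies the majorant for exchanging the u- and x-integrals.\<close>

lemma bessel_kernel_bounded_and_laplace:
  assumes "\<rho> \<ge> 0" "k + (\<rho> - 3) / 2 \<ge> 0"
  obtains C where "C \<ge> 0" "\<And>c x. c > 0 \<Longrightarrow> x > 0 \<Longrightarrow> \<bar>bessel_kernel k \<rho> c x\<bar> \<le> C"
    "\<And>c y. c > 0 \<Longrightarrow> y > 0 \<Longrightarrow> has_laplace (\<lambda>x. x powr ((\<rho> + 1) / 2) * bessel_kernel k \<rho> c x) y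
       ((4 * pi\<^sup>2 * c) powr ((\<rho> + 1) / 2) * y powr (- \<rho> - 2) * (exp (4 * pi\<^sup>2 * c / y) *
          (4 * pi\<^sup>2 * c / y) powr (k - 1) * upper_Gamma (1 - k) (2 * (4 * pi\<^sup>2 * c / y))))"
proof -
  obtain B where B: "B \<ge> 0" "\<And>x. x > 0 \<Longrightarrow> \<bar>bessel_J (\<rho> + 1) x\<bar> \<le> B"
    using bessel_J_bounded[of "\<rho> + 1"] assms by auto
  let ?q = "\<lambda>u::real. indicator {0<..<1/2} u * (u powr (k + (\<rho> - 3) / 2) / (1 - u) powr ((1 + \<rho>) / 2))"
  let ?b = "\<lambda>c u x. bessel_J (\<rho> + 1) (2 * sqrt (4 * pi\<^sup>2 * c * (1 - u) / u * x))"
  \<comment> \<open>On (0, 1/2) one has 1 / (1 - u) <= 2, and B bounds the Bessel factor.\<close>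
  define K where "K = 2 powr ((1 + \<rho>) / 2) * B"
  define w :: "real \<Rightarrow> real" where "w = (\<lambda>u. indicator {0<..<1/2} u * K)"
  have K: "K \<ge> 0" using B by (simp add: K_def)
  have w: "integrable lborel w"
  proof -
    have "emeasure lborel {0<..<1/2::real} < \<infinity>"
      by (subst emeasure_lborel_Ioo) (simp, simp only: infinity_ennreal_def ennreal_less_top)
    then show ?thesis
      unfolding w_def by (intro integrable_mult_left integrable_real_indicator) auto
  qed
  have ker: "bessel_kernel k \<rho> c x = (LBINT u. ?q u * ?b c u x)" for c x
  proof -
    have "2 * sqrt (4 * pi\<^sup>2 * c * (1 - u) / u * x) = 4 * pi * sqrt (c * x * (1 - u) / u)" for u
    proof -
      have "4 * pi\<^sup>2 * c * (1 - u) / u * x = (2 * pi)\<^sup>2 * (c * x * (1 - u) / u)"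
        by (simp add: power2_eq_square)
      then show ?thesis by (simp only: real_sqrt_mult real_sqrt_abs) simp
    qed
    then show ?thesis
      unfolding bessel_kernel_def
      by (simp add: interval_lebesgue_integral_def set_lebesgue_integral_def einterval_eq(1) zero_ereal_def mult_ac)
  qed
  have bound: "\<bar>?q u * ?b c u x\<bar> \<le> w u" if "c > 0" "x > 0" for c x u
  proof (cases "u \<in> {0<..<1/2}")
    case True
    have 1: "u powr (k + (\<rho> - 3) / 2) \<le> 1" using True assms by (intro powr_le1) auto
    have "1 / (1 - u) powr ((1 + \<rho>) / 2) = (1 / (1 - u)) powr ((1 + \<rho>) / 2)"
      using True by (simp add: powr_divide)
    also have "\<dots> \<le> 2 powr ((1 + \<rho>) / 2)"
      using True assms by (intro powr_mono2) (auto simp: field_simps)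
    finally have 2: "1 / (1 - u) powr ((1 + \<rho>) / 2) \<le> 2 powr ((1 + \<rho>) / 2)" .
    have 3: "\<bar>?b c u x\<bar> \<le> B"
      using True that by (intro B) auto
    have "u powr (k + (\<rho> - 3) / 2) * (1 / (1 - u) powr ((1 + \<rho>) / 2)) * \<bar>?b c u x\<bar> \<le>
        1 * 2 powr ((1 + \<rho>) / 2) * B"
      by (intro mult_mono 1 2 3) auto
    then show ?thesis using True by (simp add: w_def K_def abs_mult)
  qed (simp add: w_def)
  show ?thesis
  proof (rule that)
    show "integral\<^sup>L lborel w \<ge> 0"
      by (intro Bochner_Integration.integral_nonneg) (use K in \<open>simp add: w_def\<close>)
    fix c :: real assume c: "c > 0"
    show "\<bar>bessel_kernel k \<rho> c x\<bar> \<le> integral\<^sup>L lborel w" if "x > 0" for x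
    proof -
      have "integrable lborel (\<lambda>u. ?q u * ?b c u x)"
        by (rule Bochner_Integration.integrable_bound[OF w])
           (measurable, use order.trans[OF bound[OF c that] abs_ge_self] in auto)
      then have "norm (LBINT u. ?q u * ?b c u x) \<le> integral\<^sup>L lborel w"
        by (intro Bochner_Integration.integral_norm_bound_integral w) (use bound[OF c that] in auto)
      then show ?thesis unfolding ker by simp
    qed
    fix y :: real assume y: "y > 0"
    define A where "A = 4 * pi\<^sup>2 * c / y"
    have A: "A > 0" "A * y = 4 * pi\<^sup>2 * c" using c y by (auto simp: A_def)
    let ?F = "\<lambda>u. (A * y) powr ((\<rho> + 1) / 2) * y powr (- \<rho> - 2) *
       (indicator {0<..<1/2} u * (u powr (k - 2) * exp (- (A * (1 - u) / u))))"
    have "has_laplace (\<lambda>x. LBINT u. x powr ((\<rho> + 1) / 2) * (?q u * ?b c u x)) y (LBINT u. ?F u)"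
    proof (rule has_laplace_integral[OF _ _ w])
      show "has_laplace (\<lambda>x. x powr ((\<rho> + 1) / 2)) y (Gamma ((\<rho> + 1) / 2 + 1) * y powr (- ((\<rho> + 1) / 2) - 1))"
        by (rule has_laplace_powr) (use assms y in auto)
      show "\<bar>x powr ((\<rho> + 1) / 2) * (?q u * ?b c u x)\<bar> \<le> w u * x powr ((\<rho> + 1) / 2)" if "x > 0" for u x
        using mult_left_mono[OF bound[OF c that, of u], of "x powr ((\<rho> + 1) / 2)"]
        by (simp add: abs_mult mult_ac)
      show "(\<lambda>(u, x). x powr ((\<rho> + 1) / 2) * (?q u * ?b c u x)) \<in> borel_measurable (borel \<Otimes>\<^sub>M borel)"
        by measurable
      show "has_laplace (\<lambda>x. x powr ((\<rho> + 1) / 2) * (?q u * ?b c u x)) y (?F u)" for u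
      proof (cases "u \<in> {0<..<1/2}")
        case True
        define a where "a = 4 * pi\<^sup>2 * c * (1 - u) / u"
        have a: "a > 0" using True c by (simp add: a_def)
        have "has_laplace (\<lambda>x. ?q u * (x powr ((\<rho> + 1) / 2) * bessel_J (\<rho> + 1) (2 * sqrt (a * x)))) y
           (?q u * (a powr ((\<rho> + 1) / 2) * (y powr (- (\<rho> + 1) - 1) * exp (- a / y))))"
          using assms a y by (intro has_laplace_mult has_laplace_bessel_J) auto
        moreover have "?q u * (a powr ((\<rho> + 1) / 2) * (y powr (- (\<rho> + 1) - 1) * exp (- a / y))) = ?F u"
        proof -
          have e: "- (\<rho> + 1) - 1 = - \<rho> - 2" "- a / y = - (A * (1 - u) / u)"
            using y by (auto simp: a_def A_def)
          \<comment> \<open>The power of 1 - u produced by the transform cancels the one in the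
            kernel, and the powers of u combine to u^(k-2).\<close>
          have "a = A * y * ((1 - u) / u)" by (simp add: a_def A)
          then have "a powr ((\<rho> + 1) / 2) = (A * y) powr ((\<rho> + 1) / 2) * ((1 - u) powr ((1 + \<rho>) / 2) / u powr ((\<rho> + 1) / 2))"
            using True A(1) y by (simp only: powr_mult powr_divide) (simp add: add.commute)
          moreover have "u powr (k + (\<rho> - 3) / 2) / u powr ((\<rho> + 1) / 2) = u powr (k - 2)"
          proof -
            have "k + (\<rho> - 3) / 2 - (\<rho> + 1) / 2 = k - 2" by (simp add: field_simps)
            then show ?thesis by (metis powr_diff)
          qed
          ultimately show ?thesis
            unfolding e using True by (simp add: mult_ac) (simp add: divide_simps)
        qed
        ultimately show ?thesis by (simp add: a_def mult_ac)
      next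
        case False
        then show ?thesis by (simp add: has_laplace_def has_bochner_integral_zero)
      qed
    qed
    moreover have "(LBINT u. ?F u) = (A * y) powr ((\<rho> + 1) / 2) * y powr (- \<rho> - 2) *
        (exp A * A powr (k - 1) * upper_Gamma (1 - k) (2 * A))"
      using has_bochner_integral_exp_reciprocal[OF A(1), of k]
      unfolding has_bochner_integral_iff by simp
    moreover have "(\<lambda>x. LBINT u. x powr ((\<rho> + 1) / 2) * (?q u * ?b c u x)) =
        (\<lambda>x. x powr ((\<rho> + 1) / 2) * (LBINT u. ?q u * ?b c u x))"
      by (intro ext integral_mult_right_zero)
    ultimately show "has_laplace (\<lambda>x. x powr ((\<rho> + 1) / 2) * bessel_kernel k \<rho> c x) y
       ((4 * pi\<^sup>2 * c) powr ((\<rho> + 1) / 2) * y powr (- \<rho> - 2) * (exp (4 * pi\<^sup>2 * c / y) *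
          (4 * pi\<^sup>2 * c / y) powr (k - 1) * upper_Gamma (1 - k) (2 * (4 * pi\<^sup>2 * c / y))))"
      unfolding A(2) A_def[symmetric] ker by (simp only:)
  qed
qed

subsection \<open>Transforms of the Dirichlet-type sums\<close>

text \<open>The finitely many indices before the asymptotic bound are absorbed into the constant.
  Index 0 is excluded because \<open>0 powr \<mu> = 0\<close>.\<close>

lemma bigo_powr_bound:
  fixes a :: "nat \<Rightarrow> complex"
  assumes "(\<lambda>n. norm (a n)) \<in> O(\<lambda>n. real n powr \<mu>)"
  obtains C where "C \<ge> 0" "\<And>n. n \<ge> 1 \<Longrightarrow> norm (a n) \<le> C * real n powr \<mu>"
proof -
  obtain c where c: "c > 0" "eventually (\<lambda>n. norm (a n) \<le> c * real n powr \<mu>) at_top"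
    using assms by (auto elim!: landau_o.bigE)
  then obtain n0 where n0: "\<And>n. n \<ge> n0 \<Longrightarrow> norm (a n) \<le> c * real n powr \<mu>"
    by (auto simp: eventually_at_top_linorder)
  \<comment> \<open>The summand at m = 0 is 0, by division by zero; each other summand is a ratio
    that has to be dominated.\<close>
  define S where "S = (\<Sum>m<n0. norm (a m) / real m powr \<mu>)"
  have S: "S \<ge> 0" unfolding S_def by (intro sum_nonneg) auto
  have "norm (a n) \<le> (c + S) * real n powr \<mu>" if n: "n \<ge> 1" for n
  proof (cases "n \<ge> n0")
    case True
    have "norm (a n) \<le> c * real n powr \<mu>" by (rule n0[OF True])
    also have "\<dots> \<le> (c + S) * real n powr \<mu>" using S by (intro mult_right_mono) auto
    finally show ?thesis .
  next
    case False
    have "norm (a n) / real n powr \<mu> \<le> S"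
      unfolding S_def using False by (intro member_le_sum) auto
    then have "norm (a n) \<le> S * real n powr \<mu>" using n by (simp add: pos_divide_le_eq)
    also have "\<dots> \<le> (c + S) * real n powr \<mu>" using c by (intro mult_right_mono) auto
    finally show ?thesis .
  qed
  then show ?thesis using that[of "c + S"] S c by auto
qed

lemma summable_powr_exp:
  fixes c :: real
  assumes "c > 0"
  shows "summable (\<lambda>m. real (Suc m) powr \<mu> * exp (- (c * real (Suc m))))"
proof -
  have "(\<lambda>n. real n powr \<mu> * exp (- (c * real n))) \<in> O(\<lambda>n. real n powr (-2))"
    using assms by real_asymp
  then have "summable (\<lambda>n. real n powr \<mu> * exp (- (c * real n)))"
    by (rule summable_comparison_test_bigo[rotated]) (simp add: summable_real_powr_iff)
  then show ?thesis by (subst (asm) summable_Suc_iff[symmetric]) simp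
qed

text \<open>One criterion for the plain exponentials attached to a^+ and b^+ and for the incomplete
  Gamma factors attached to a^- and b^-.\<close>

lemma summable_coeff_exp:
  fixes a :: "nat \<Rightarrow> complex"
  assumes "(\<lambda>n. norm (a n)) \<in> O(\<lambda>n. real n powr \<mu>)" "c > 0" "K \<ge> 0"
    and "\<And>m. \<bar>e m\<bar> \<le> K * exp (- (c * real (Suc m)))"
  shows "summable (\<lambda>m. norm (a (Suc m)) * \<bar>e m :: real\<bar>)"
proof -
  obtain C where C: "C \<ge> 0" "\<And>n. n \<ge> 1 \<Longrightarrow> norm (a n) \<le> C * real n powr \<mu>"
    using bigo_powr_bound[OF assms(1)] by metis
  show ?thesis
  proof (rule summable_comparison_test'[of _ 0])
    show "summable (\<lambda>m. (C * K) * (real (Suc m) powr \<mu> * exp (- (c * real (Suc m)))))"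
      by (intro summable_mult summable_powr_exp assms)
    show "norm (norm (a (Suc m)) * \<bar>e m\<bar>) \<le> (C * K) * (real (Suc m) powr \<mu> * exp (- (c * real (Suc m))))" for m
      using mult_mono[OF C(2)[of "Suc m"] assms(4)[of m]] C(1) by (simp add: mult_ac)
  qed
qed

lemma summable_coeff_powr:
  fixes a :: "nat \<Rightarrow> complex"
  assumes "(\<lambda>n. norm (a n)) \<in> O(\<lambda>n. real n powr \<mu>)" "s > \<mu> + 1"
  shows "summable (\<lambda>m. norm (a (Suc m) / of_real (real (Suc m) powr s)))"
proof -
  obtain C where C: "C \<ge> 0" "\<And>n. n \<ge> 1 \<Longrightarrow> norm (a n) \<le> C * real n powr \<mu>"
    using bigo_powr_bound[OF assms(1)] by metis
  have "summable (\<lambda>n. real n powr (\<mu> - s))" using assms by (simp add: summable_real_powr_iff)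
  then have "summable (\<lambda>m. C * real (Suc m) powr (\<mu> - s))"
    by (subst (asm) summable_Suc_iff[symmetric]) (rule summable_mult)
  then show ?thesis
  proof (rule summable_comparison_test'[of _ 0])
    show "norm (norm (a (Suc m) / of_real (real (Suc m) powr s))) \<le> C * real (Suc m) powr (\<mu> - s)" for m
      using divide_right_mono[OF C(2)[of "Suc m"], of "real (Suc m) powr s"]
      by (simp add: norm_divide powr_diff)
  qed
qed

text \<open>The situation of a^+ and a^-: at each x only finitely many terms are nonzero, so
  pointwise convergence is free, and nonnegativity lets the \<open>\<phi> m\<close> serve as their
  own majorants. Only the transforms need to be summable.\<close>

lemma has_laplace_finite_series:
  fixes a :: "nat \<Rightarrow> complex"
  assumes L: "\<And>m. has_laplace (\<phi> m) y (\<Phi> m)"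
    and nn: "\<And>m x. x > 0 \<Longrightarrow> \<phi> m x \<ge> 0" and z: "\<And>m x. x > 0 \<Longrightarrow> x \<le> real m \<Longrightarrow> \<phi> m x = 0"
    and s: "summable (\<lambda>m. norm (a m) * \<bar>\<Phi> m\<bar>)"
  shows "has_laplace (\<lambda>x. \<Sum>m. a m * of_real (\<phi> m x)) y (\<Sum>m. a m * of_real (\<Phi> m))"
proof (rule has_laplace_suminf(1))
  show "has_laplace (\<lambda>x. a m * of_real (\<phi> m x)) y (a m * of_real (\<Phi> m))" for m
    by (intro has_laplace_mult has_laplace_of_real L)
  show "has_laplace (\<lambda>x. norm (a m) * \<phi> m x) y (norm (a m) * \<Phi> m)" for m
    by (intro has_laplace_mult L)
  show "norm (a m * of_real (\<phi> m x)) \<le> norm (a m) * \<phi> m x" if "x > 0" for m x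
    using nn[OF that] by (simp add: norm_mult)
  show "summable (\<lambda>m. norm (a m) * \<phi> m x)" if "x > 0" for x
  proof (rule summable_finite[of "{..nat \<lceil>x\<rceil>}"])
    show "norm (a m) * \<phi> m x = 0" if "m \<notin> {..nat \<lceil>x\<rceil>}" for m
    proof -
      have "x \<le> real m" using that by (simp add: not_le) linarith
      then show ?thesis using z[OF \<open>x > 0\<close>] by simp
    qed
  qed simp
  show "summable (\<lambda>m. norm (a m) * \<Phi> m)"
    by (rule summable_comparison_test'[OF s, of 0]) (simp add: abs_mult)
qed

text \<open>The situation of b^+ and b^-: every term contributes at every x, so one majorant
  \<open>g\<close> for all m is paired with absolutely summable coefficients.\<close>

lemma has_laplace_dominated_series:
  fixes a :: "nat \<Rightarrow> complex"
  assumes L: "\<And>m. has_laplace (\<phi> m) y (\<Phi> m)" and g: "has_laplace g y G"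
    and le: "\<And>m x. x > 0 \<Longrightarrow> \<bar>\<phi> m x\<bar> \<le> g x" and s: "summable (\<lambda>m. norm (a m))"
  shows "has_laplace (\<lambda>x. \<Sum>m. a m * of_real (\<phi> m x)) y (\<Sum>m. a m * of_real (\<Phi> m))"
proof (rule has_laplace_suminf(1))
  show "has_laplace (\<lambda>x. a m * of_real (\<phi> m x)) y (a m * of_real (\<Phi> m))" for m
    by (intro has_laplace_mult has_laplace_of_real L)
  show "has_laplace (\<lambda>x. norm (a m) * g x) y (norm (a m) * G)" for m
    by (intro has_laplace_mult g)
  show "norm (a m * of_real (\<phi> m x)) \<le> norm (a m) * g x" if "x > 0" for m x
    using le[OF that, of m] by (simp add: norm_mult mult_left_mono)
qed (intro summable_mult2 s)+

text \<open>Links the sums over 1 <= n <= x to series indexed by m = n - 1, the form in which the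
  exchange is available.\<close>

lemma suminf_Suc_eq_sum:
  fixes h :: "nat \<Rightarrow> complex"
  assumes "\<And>n. real n > x \<Longrightarrow> h n = 0"
  shows "(\<Sum>m. h (Suc m)) = (\<Sum>n\<in>{n. 1 \<le> n \<and> real n \<le> x}. h n)"
proof -
  have fin: "finite {n::nat. real n \<le> x}"
    by (rule finite_subset[of _ "{..nat \<lceil>x\<rceil>}"]) (auto, linarith)
  have im: "{n. 1 \<le> n \<and> real n \<le> x} = Suc ` {m. real (Suc m) \<le> x}"
    by (auto simp: image_iff gr0_conv_Suc Suc_le_eq)
  have "(\<Sum>m. h (Suc m)) = (\<Sum>m\<in>{m. real (Suc m) \<le> x}. h (Suc m))"
    by (rule suminf_finite) (auto intro!: finite_subset[OF _ fin] assms simp: not_le)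
  also have "\<dots> = (\<Sum>n\<in>{n. 1 \<le> n \<and> real n \<le> x}. h n)"
    unfolding im by (subst sum.reindex) auto
  finally show ?thesis .
qed

section \<open>The left side of the identity: Riesz sums, incomplete Gamma series and Q\<close>

lemma has_laplace_Riesz_sum:
  assumes "(\<lambda>n. norm (a n)) \<in> O(\<lambda>n. real n powr \<mu>)" "\<rho> > 0" "y > 0"
  shows "has_laplace (\<lambda>x. 1 / of_real (Gamma (\<rho> + 1)) *
            (\<Sum>n\<in>{n::nat. 1 \<le> n \<and> real n \<le> x}. a n * of_real ((x - real n) powr \<rho>))) y
      (of_real (y powr (- \<rho> - 1)) * (\<Sum>m. a (Suc m) * of_real (exp (- (real (Suc m) * y)))))"
    and "summable (\<lambda>m. a (Suc m) * complex_of_real (exp (- (real (Suc m) * y))))"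
proof -
  have s: "summable (\<lambda>m. norm (a (Suc m)) * \<bar>exp (- (real (Suc m) * y))\<bar>)"
    by (rule summable_coeff_exp[OF assms(1,3), of 1]) (auto simp: mult.commute)
  then show sa: "summable (\<lambda>m. a (Suc m) * complex_of_real (exp (- (real (Suc m) * y))))"
    by (intro summable_norm_cancel[of "\<lambda>m. a (Suc m) * _ m"]) (simp add: norm_mult)
  define G where "G = Gamma (\<rho> + 1)"
  have G: "G > 0" unfolding G_def using assms by (intro Gamma_real_pos) auto
  have "has_laplace (\<lambda>x. \<Sum>m. a (Suc m) * of_real (indicator {real (Suc m)..} x * (x - real (Suc m)) powr \<rho>)) y
      (\<Sum>m. a (Suc m) * of_real (G * (exp (- (real (Suc m) * y)) * y powr (- \<rho> - 1))))"
  proof (rule has_laplace_finite_series)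
    show "has_laplace (\<lambda>x. indicator {real (Suc m)..} x * (x - real (Suc m)) powr \<rho>) y
        (G * (exp (- (real (Suc m) * y)) * y powr (- \<rho> - 1)))" for m
      unfolding G_def by (rule has_laplace_shift) (use assms in auto)
    have "summable (\<lambda>m. (G * y powr (- \<rho> - 1)) * (norm (a (Suc m)) * \<bar>exp (- (real (Suc m) * y))\<bar>))"
      by (intro summable_mult s)
    then show "summable (\<lambda>m. norm (a (Suc m)) * \<bar>G * (exp (- (real (Suc m) * y)) * y powr (- \<rho> - 1))\<bar>)"
      using G by (simp add: abs_mult mult_ac)
  qed auto
  also have "(\<Sum>m. a (Suc m) * of_real (G * (exp (- (real (Suc m) * y)) * y powr (- \<rho> - 1)))) =
      of_real (G * y powr (- \<rho> - 1)) * (\<Sum>m. a (Suc m) * of_real (exp (- (real (Suc m) * y))))"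
    by (subst suminf_mult[OF sa, symmetric]) (simp add: mult_ac)
  finally have "has_laplace (\<lambda>x. 1 / of_real G *
       (\<Sum>m. a (Suc m) * of_real (indicator {real (Suc m)..} x * (x - real (Suc m)) powr \<rho>))) y
      (1 / of_real G * (of_real (G * y powr (- \<rho> - 1)) * (\<Sum>m. a (Suc m) * of_real (exp (- (real (Suc m) * y))))))"
    by (rule has_laplace_mult)
  then show "has_laplace (\<lambda>x. 1 / of_real (Gamma (\<rho> + 1)) *
            (\<Sum>n\<in>{n::nat. 1 \<le> n \<and> real n \<le> x}. a n * of_real ((x - real n) powr \<rho>))) y
      (of_real (y powr (- \<rho> - 1)) * (\<Sum>m. a (Suc m) * of_real (exp (- (real (Suc m) * y)))))"
  proof (rule has_laplace_cong[THEN iffD1, rotated -1])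
    fix x :: real
    have "(\<Sum>m. a (Suc m) * of_real (indicator {real (Suc m)..} x * (x - real (Suc m)) powr \<rho>)) =
        (\<Sum>n\<in>{n. 1 \<le> n \<and> real n \<le> x}. a n * of_real (indicator {real n..} x * (x - real n) powr \<rho>))"
      by (rule suminf_Suc_eq_sum) auto
    also have "\<dots> = (\<Sum>n\<in>{n. 1 \<le> n \<and> real n \<le> x}. a n * of_real ((x - real n) powr \<rho>))"
      by (intro sum.cong) auto
    finally show "1 / of_real G *
       (\<Sum>m. a (Suc m) * of_real (indicator {real (Suc m)..} x * (x - real (Suc m)) powr \<rho>)) =
       1 / of_real (Gamma (\<rho> + 1)) *
            (\<Sum>n\<in>{n::nat. 1 \<le> n \<and> real n \<le> x}. a n * of_real ((x - real n) powr \<rho>))"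
      by (simp add: G_def)
  qed (use G in simp)
qed

lemma exp_upper_Gamma_le:
  assumes "y > 0"
  obtains K where "K \<ge> 0"
    "\<And>m. \<bar>exp (real (Suc m) * y) * upper_Gamma s (2 * real (Suc m) * y)\<bar> \<le> K * exp (- (y / 2 * real (Suc m)))"
proof -
  \<comment> \<open>The least argument that occurs is 2 y, at m = 0; it is the \<open>z0\<close> of
    \<open>upper_Gamma_le\<close>.\<close>
  define K where "K = (1 / 4) powr (- s) * upper_Gamma s (2 * y / 4)"
  have "K \<ge> 0" unfolding K_def using assms by (intro mult_nonneg_nonneg upper_Gamma_nonneg) auto
  moreover have "\<bar>exp (real (Suc m) * y) * upper_Gamma s (2 * real (Suc m) * y)\<bar> \<le> K * exp (- (y / 2 * real (Suc m)))" for m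
  proof -
    have "upper_Gamma s (2 * real (Suc m) * y) \<le> K * exp (- 3 * (2 * real (Suc m) * y) / 4)"
      unfolding K_def by (rule upper_Gamma_le) (use assms in auto)
    then have "exp (real (Suc m) * y) * upper_Gamma s (2 * real (Suc m) * y) \<le>
        exp (real (Suc m) * y) * (K * exp (- 3 * (2 * real (Suc m) * y) / 4))"
      by (rule mult_left_mono) simp
    also have "\<dots> = K * (exp (real (Suc m) * y) * exp (- 3 * (2 * real (Suc m) * y) / 4))" by simp
    \<comment> \<open>With n = m + 1 the exponents add up to n y - (3/4) 2 n y = - n y / 2.\<close>
    also have "exp (real (Suc m) * y) * exp (- 3 * (2 * real (Suc m) * y) / 4) = exp (- (y / 2 * real (Suc m)))"
      unfolding exp_add[symmetric] by (rule arg_cong[of _ _ exp]) (simp add: field_simps)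
    finally show ?thesis
      using upper_Gamma_nonneg[of "2 * real (Suc m) * y" s] assms by (simp add: abs_mult)
  qed
  ultimately show ?thesis using that by blast
qed

text \<open>Used at y itself for a^-, and at the dual parameter 4 pi^2 / (N y) for b^-.\<close>

lemma summable_upper_Gamma_series:
  fixes a :: "nat \<Rightarrow> complex"
  assumes "(\<lambda>n. norm (a n)) \<in> O(\<lambda>n. real n powr \<mu>)" "y > 0"
  shows "summable (\<lambda>m. norm (a (Suc m)) * \<bar>exp (real (Suc m) * y) * upper_Gamma s (2 * real (Suc m) * y)\<bar>)"
    and "summable (\<lambda>m. a (Suc m) * complex_of_real (exp (real (Suc m) * y) * upper_Gamma s (2 * real (Suc m) * y)))"
proof -
  obtain K where "K \<ge> 0"
    "\<And>m. \<bar>exp (real (Suc m) * y) * upper_Gamma s (2 * real (Suc m) * y)\<bar> \<le> K * exp (- (y / 2 * real (Suc m)))"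
    using exp_upper_Gamma_le[OF assms(2)] by metis
  then show 1: "summable (\<lambda>m. norm (a (Suc m)) * \<bar>exp (real (Suc m) * y) * upper_Gamma s (2 * real (Suc m) * y)\<bar>)"
    by (intro summable_coeff_exp[OF assms(1), of "y / 2"]) (use assms in auto)
  show "summable (\<lambda>m. a (Suc m) * complex_of_real (exp (real (Suc m) * y) * upper_Gamma s (2 * real (Suc m) * y)))"
    by (rule summable_norm_cancel) (use 1 in \<open>simp only: norm_mult norm_of_real\<close>)
qed

lemma has_laplace_g_fun_sum:
  assumes a: "(\<lambda>n. norm (a n)) \<in> O(\<lambda>n. real n powr \<mu>)" and "k + \<rho> > 1" "y > 0"
  shows "has_laplace (\<lambda>x. of_real (x powr \<rho>) / (2 * of_real pi * \<i>) *
            (\<Sum>n\<in>{n::nat. 1 \<le> n \<and> real n \<le> x}. a n * g_fun k \<rho> n x)) y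
      (of_real (y powr (- \<rho> - 1)) *
        (\<Sum>m. a (Suc m) * of_real (exp (real (Suc m) * y) * upper_Gamma (1 - k) (2 * real (Suc m) * y))))"
proof -
  let ?\<phi> = "\<lambda>n x. (LBINT s. indicator {2 * real n<..<x + real n} s *
     (s powr (- k) * (x + real n - s) powr (k + \<rho> - 1))) / Gamma (k + \<rho>)"
  note s = summable_upper_Gamma_series[OF a assms(3), of "1 - k"]
  have "has_laplace (\<lambda>x. \<Sum>m. a (Suc m) * of_real (?\<phi> (Suc m) x)) y
      (\<Sum>m. a (Suc m) * of_real (y powr (- \<rho> - 1) *
         (exp (real (Suc m) * y) * upper_Gamma (1 - k) (2 * real (Suc m) * y))))"
  proof (rule has_laplace_finite_series)
    show "has_laplace (?\<phi> (Suc m)) y (y powr (- \<rho> - 1) *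
         (exp (real (Suc m) * y) * upper_Gamma (1 - k) (2 * real (Suc m) * y)))" for m
      by (rule has_laplace_g_fun) (use assms in auto)
    show "?\<phi> (Suc m) x \<ge> 0" for m x
      using assms by (intro divide_nonneg_nonneg Bochner_Integration.integral_nonneg) auto
    show "?\<phi> (Suc m) x = 0" if "x \<le> real m" for m x
      using that by simp
    show "summable (\<lambda>m. norm (a (Suc m)) * \<bar>y powr (- \<rho> - 1) *
         (exp (real (Suc m) * y) * upper_Gamma (1 - k) (2 * real (Suc m) * y))\<bar>)"
      using summable_mult[OF s(1), of "y powr (- \<rho> - 1)"] by (simp add: abs_mult mult_ac)
  qed
  also have "(\<Sum>m. a (Suc m) * of_real (y powr (- \<rho> - 1) *
         (exp (real (Suc m) * y) * upper_Gamma (1 - k) (2 * real (Suc m) * y)))) =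
      of_real (y powr (- \<rho> - 1)) *
        (\<Sum>m. a (Suc m) * of_real (exp (real (Suc m) * y) * upper_Gamma (1 - k) (2 * real (Suc m) * y)))"
    by (subst suminf_mult[OF s(2), symmetric]) (simp add: mult_ac)
  finally show ?thesis
  proof (rule has_laplace_cong[THEN iffD1, rotated -1])
    fix x :: real
    have "(\<Sum>m. a (Suc m) * of_real (?\<phi> (Suc m) x)) =
        (\<Sum>n\<in>{n. 1 \<le> n \<and> real n \<le> x}. a n * of_real (?\<phi> n x))"
      by (rule suminf_Suc_eq_sum) auto
    also have "\<dots> = (\<Sum>n\<in>{n. 1 \<le> n \<and> real n \<le> x}.
        of_real (x powr \<rho>) / (2 * of_real pi * \<i>) * (a n * g_fun k \<rho> n x))"
    proof (intro sum.cong refl)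
      fix n assume n: "n \<in> {n. 1 \<le> n \<and> real n \<le> x}"
      have "of_real (?\<phi> n x) = of_real (x powr \<rho>) / (2 * of_real pi * \<i>) * g_fun k \<rho> n x"
        by (rule g_fun_eq[symmetric]) (use n in auto)
      then show "a n * of_real (?\<phi> n x) = of_real (x powr \<rho>) / (2 * of_real pi * \<i>) * (a n * g_fun k \<rho> n x)"
        by (simp only: mult_ac)
    qed
    finally show "(\<Sum>m. a (Suc m) * of_real (?\<phi> (Suc m) x)) = of_real (x powr \<rho>) / (2 * of_real pi * \<i>) *
            (\<Sum>n\<in>{n::nat. 1 \<le> n \<and> real n \<le> x}. a n * g_fun k \<rho> n x)"
      by (simp only: sum_distrib_left)
  qed simp
qed

text \<open>Q is a combination of x^rho, x^(rho+1), x^(rho+k-1) and x^(rho+k), and its Gamma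
  denominators are exactly the Gamma factors that these powers produce.\<close>

lemma has_laplace_Q_fun:
  assumes "\<rho> > 0" "k + \<rho> > 1" "y > 0"
  shows "has_laplace (Q_fun k N ap am bp bm \<rho>) y (of_real (y powr (- \<rho> - 1)) *
     (- ap 0 + of_real (2 * pi * real N powr (k / 2 - 1)) * \<i> powr of_real k / of_real y * bm 0
        - of_real ((2 * pi) powr (k - 1) / y powr (k - 1)) * am 0
        + \<i> powr of_real k * of_real ((2 * pi) powr k)
            / of_real (real N powr (k / 2) * y powr k) * bp 0))"
proof -
  have L: "has_laplace (\<lambda>x. c * complex_of_real (x powr \<nu>)) y (c * of_real (Gamma (\<nu> + 1) * y powr (- \<nu> - 1)))"
    if "\<nu> > -1" for c \<nu>
    by (intro has_laplace_mult has_laplace_of_real has_laplace_powr that assms)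
  let ?W = "\<i> powr of_real k"
  define c1 where "c1 = - (ap 0 / of_real (Gamma (\<rho> + 1)))"
  define c2 where "c2 = of_real (2 * pi * real N powr (k / 2 - 1)) * bm 0 * ?W / of_real (Gamma (\<rho> + 2))"
  define c3 where "c3 = - (am 0 * of_real ((2 * pi) powr (k - 1)) / of_real (Gamma (\<rho> + k)))"
  define c4 where "c4 = bp 0 * ?W * of_real ((2 * pi) powr k) / of_real (real N powr (k / 2) * Gamma (\<rho> + k + 1))"
  have G: "Gamma (\<rho> + 1) > 0" "Gamma (\<rho> + 2) > 0" "Gamma (\<rho> + k) > 0" "Gamma (\<rho> + k + 1) > 0"
    using assms by (auto intro!: Gamma_real_pos)
  have ar: "\<rho> + 1 + 1 = \<rho> + 2" "\<rho> + k - 1 + 1 = \<rho> + k" by auto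
  have pw: "y powr (- (\<rho> + 1) - 1) = y powr (- \<rho> - 1) / y"
    "y powr (- (\<rho> + k - 1) - 1) = y powr (- \<rho> - 1) / y powr (k - 1)"
    "y powr (- (\<rho> + k) - 1) = y powr (- \<rho> - 1) / y powr k"
    using assms powr_diff[of y "- \<rho> - 1" 1] powr_diff[of y "- \<rho> - 1" "k - 1"] powr_diff[of y "- \<rho> - 1" k]
    by (simp_all add: algebra_simps)
  have "has_laplace (\<lambda>x. c1 * complex_of_real (x powr \<rho>) + c2 * complex_of_real (x powr (\<rho> + 1))
      + c3 * complex_of_real (x powr (\<rho> + k - 1)) + c4 * complex_of_real (x powr (\<rho> + k))) y
     (c1 * of_real (Gamma (\<rho> + 1) * y powr (- \<rho> - 1)) + c2 * of_real (Gamma (\<rho> + 1 + 1) * y powr (- (\<rho> + 1) - 1))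
      + c3 * of_real (Gamma (\<rho> + k - 1 + 1) * y powr (- (\<rho> + k - 1) - 1))
      + c4 * of_real (Gamma (\<rho> + k + 1) * y powr (- (\<rho> + k) - 1)))"
    by (intro has_laplace_add L) (use assms in auto)
  then show ?thesis
  proof (rule has_laplace_cong[THEN iffD1, rotated -1])
    fix x :: real assume x: "x > 0"
    have "x powr (\<rho> + 1) = x powr \<rho> * x" "x powr (\<rho> + k - 1) = x powr \<rho> * x powr (k - 1)"
      "x powr (\<rho> + k) = x powr \<rho> * x powr k"
      using x by (auto simp: powr_add powr_diff)
    then show "c1 * complex_of_real (x powr \<rho>) + c2 * complex_of_real (x powr (\<rho> + 1))
      + c3 * complex_of_real (x powr (\<rho> + k - 1)) + c4 * complex_of_real (x powr (\<rho> + k)) =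
      Q_fun k N ap am bp bm \<rho> x"
      unfolding Q_fun_def c1_def c2_def c3_def c4_def
      by (simp add: algebra_simps)
  next
    show "c1 * of_real (Gamma (\<rho> + 1) * y powr (- \<rho> - 1)) + c2 * of_real (Gamma (\<rho> + 1 + 1) * y powr (- (\<rho> + 1) - 1))
      + c3 * of_real (Gamma (\<rho> + k - 1 + 1) * y powr (- (\<rho> + k - 1) - 1))
      + c4 * of_real (Gamma (\<rho> + k + 1) * y powr (- (\<rho> + k) - 1)) =
      of_real (y powr (- \<rho> - 1)) *
     (- ap 0 + of_real (2 * pi * real N powr (k / 2 - 1)) * ?W / of_real y * bm 0
        - of_real ((2 * pi) powr (k - 1) / y powr (k - 1)) * am 0
        + ?W * of_real ((2 * pi) powr k) / of_real (real N powr (k / 2) * y powr k) * bp 0)"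
      unfolding ar pw c1_def c2_def c3_def c4_def using G
      by (simp add: distrib_left right_diff_distrib mult_ac)
  qed
qed

section \<open>The right side of the identity: the two Bessel series\<close>

lemma powr_identity_plus:
  fixes s n y :: real
  assumes "s > 0" "n > 0" "y > 0"
  shows "(1 / s) powr \<rho> * ((s\<^sup>2 * n) powr ((\<rho> + k) / 2) / n powr ((\<rho> + k) / 2) * y powr (- (\<rho> + k) - 1)) =
    y powr (- \<rho> - 1) * (s / y) powr k"
  using assms
  by (simp add: powr_def ln_mult ln_div ln_realpow exp_add[symmetric] exp_diff[symmetric])
     (simp add: field_simps)

text \<open>As in the preceding identity, s stands for 2 pi / sqrt N. After taking logarithms both
  are linear in ln s, ln n and ln y, and the powers of n cancel completely, so no power of n
  accompanies b(n) in the conclusion.\<close>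

lemma powr_identity_minus:
  fixes s n y :: real
  assumes "s > 0" "n > 0" "y > 0"
  shows "(1 / s) powr (\<rho> + k - 1) * ((s\<^sup>2 * n) powr ((\<rho> + 1) / 2) / n powr ((\<rho> - 1) / 2 + k) *
      y powr (- \<rho> - 2) * (s\<^sup>2 * n / y) powr (k - 1)) =
    y powr (- \<rho> - 1) * (s / y) powr k"
  using assms
  by (simp add: powr_def ln_mult ln_div ln_realpow exp_add[symmetric] exp_diff[symmetric])
     (simp add: field_simps)

text \<open>The bound on J is uniform in n, so convergence rests on b(n) / n^((rho+k)/2) alone; the
  assumption (rho + k) / 2 > mu + 1 makes these absolutely summable.\<close>

lemma has_laplace_bessel_sum:
  fixes N :: nat
  assumes b: "(\<lambda>n. norm (b n)) \<in> O(\<lambda>n. real n powr \<mu>)" and \<rho>: "\<rho> + k \<ge> 0" "(\<rho> + k) / 2 > \<mu> + 1"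
    and N: "N > 0" and y: "y > 0"
    and S: "\<And>x. x > 0 \<Longrightarrow> (\<lambda>m. let n = Suc m in
           b n / of_real (real n powr ((\<rho> + k) / 2)) *
           of_real (bessel_J (\<rho> + k) (4 * pi * sqrt (real n * x / real N)))) sums S x"
  shows "has_laplace (\<lambda>x. of_real (x powr ((\<rho> + k) / 2)) * of_real ((sqrt (real N) / (2 * pi)) powr \<rho>) * S x) y
      (of_real (y powr (- \<rho> - 1)) * (of_real ((2 * pi / (sqrt (real N) * y)) powr k) *
        (\<Sum>m. b (Suc m) * of_real (exp (- (4 * real (Suc m) * pi\<^sup>2 / (real N * y)))))))"
    and "summable (\<lambda>m. b (Suc m) * complex_of_real (exp (- (4 * real (Suc m) * pi\<^sup>2 / (real N * y)))))"
proof -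
  have "summable (\<lambda>m. norm (b (Suc m)) * \<bar>exp (- (4 * real (Suc m) * pi\<^sup>2 / (real N * y)))\<bar>)"
    by (rule summable_coeff_exp[OF b, of "4 * pi\<^sup>2 / (real N * y)" 1]) (use N y in \<open>auto simp: mult_ac simp del: of_nat_Suc\<close>)
  then show sb: "summable (\<lambda>m. b (Suc m) * complex_of_real (exp (- (4 * real (Suc m) * pi\<^sup>2 / (real N * y)))))"
    by (intro summable_norm_cancel[of "\<lambda>m. b (Suc m) * _ m"]) (simp add: norm_mult)
  \<comment> \<open>With this s the Bessel argument 4 pi sqrt (n x / N) is 2 sqrt (a x) for a = s^2
    n.\<close>
  define s where "s = 2 * pi / sqrt (real N)"
  have s: "s > 0" using N by (simp add: s_def)
  have s2: "s\<^sup>2 = 4 * pi\<^sup>2 / real N" using N by (simp add: s_def power_divide)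
  have s1: "sqrt (real N) / (2 * pi) = 1 / s" "2 * pi / (sqrt (real N) * y) = s / y"
    by (simp_all add: s_def)
  define \<nu> where "\<nu> = \<rho> + k"
  let ?\<phi> = "\<lambda>m x. x powr (\<nu> / 2) * bessel_J \<nu> (2 * sqrt (s\<^sup>2 * real (Suc m) * x))"
  let ?\<Phi> = "\<lambda>m. (s\<^sup>2 * real (Suc m)) powr (\<nu> / 2) * (y powr (- \<nu> - 1) * exp (- (s\<^sup>2 * real (Suc m)) / y))"
  let ?c = "\<lambda>m. b (Suc m) / of_real (real (Suc m) powr (\<nu> / 2))"
  let ?e = "\<lambda>m. exp (- (4 * real (Suc m) * pi\<^sup>2 / (real N * y)))"
  have \<nu>: "\<nu> \<ge> 0" using \<rho> by (simp add: \<nu>_def)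
  obtain B where B: "B \<ge> 0" "\<And>x. x > 0 \<Longrightarrow> \<bar>bessel_J \<nu> x\<bar> \<le> B"
    using bessel_J_bounded[OF \<nu>] by metis
  have "has_laplace (\<lambda>x. \<Sum>m. ?c m * of_real (?\<phi> m x)) y (\<Sum>m. ?c m * of_real (?\<Phi> m))"
  proof (rule has_laplace_dominated_series)
    show "has_laplace (?\<phi> m) y (?\<Phi> m)" for m
      by (rule has_laplace_bessel_J) (use s y \<nu> in auto)
    show "has_laplace (\<lambda>x. B * x powr (\<nu> / 2)) y (B * (Gamma (\<nu> / 2 + 1) * y powr (- (\<nu> / 2) - 1)))"
      by (intro has_laplace_mult has_laplace_powr) (use \<nu> y in auto)
    show "\<bar>?\<phi> m x\<bar> \<le> B * x powr (\<nu> / 2)" if "x > 0" for m x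
      using mult_left_mono[OF B(2)[of "2 * sqrt (s\<^sup>2 * real (Suc m) * x)"], of "x powr (\<nu> / 2)"] s that
      by (simp add: abs_mult mult.commute del: of_nat_Suc)
    show "summable (\<lambda>m. norm (?c m))"
      by (rule summable_coeff_powr[OF b]) (use \<rho> in \<open>simp add: \<nu>_def\<close>)
  qed
  then have "has_laplace (\<lambda>x. of_real ((1 / s) powr \<rho>) * (\<Sum>m. ?c m * of_real (?\<phi> m x))) y
      (of_real ((1 / s) powr \<rho>) * (\<Sum>m. ?c m * of_real (?\<Phi> m)))"
    by (rule has_laplace_mult)
  then show "has_laplace (\<lambda>x. of_real (x powr ((\<rho> + k) / 2)) * of_real ((sqrt (real N) / (2 * pi)) powr \<rho>) * S x) y
      (of_real (y powr (- \<rho> - 1)) * (of_real ((2 * pi / (sqrt (real N) * y)) powr k) *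
        (\<Sum>m. b (Suc m) * of_real (exp (- (4 * real (Suc m) * pi\<^sup>2 / (real N * y)))))))"
  proof (rule has_laplace_cong[THEN iffD1, rotated -1])
    fix x :: real assume x: "x > 0"
    have j: "2 * sqrt (s\<^sup>2 * real (Suc m) * x) = 4 * pi * sqrt (real (Suc m) * x / real N)" for m
    proof -
      have "s\<^sup>2 * real (Suc m) * x = (2 * pi)\<^sup>2 * (real (Suc m) * x / real N)"
        by (simp add: s2 power_mult_distrib)
      then show ?thesis by (simp only: real_sqrt_mult real_sqrt_abs) simp
    qed
    have "(\<lambda>m. of_real (x powr (\<nu> / 2)) * (let n = Suc m in
           b n / of_real (real n powr ((\<rho> + k) / 2)) *
           of_real (bessel_J (\<rho> + k) (4 * pi * sqrt (real n * x / real N))))) sums (of_real (x powr (\<nu> / 2)) * S x)"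
      by (intro sums_mult S x)
    also have "(\<lambda>m. of_real (x powr (\<nu> / 2)) * (let n = Suc m in
           b n / of_real (real n powr ((\<rho> + k) / 2)) *
           of_real (bessel_J (\<rho> + k) (4 * pi * sqrt (real n * x / real N))))) = (\<lambda>m. ?c m * of_real (?\<phi> m x))"
      unfolding Let_def j \<nu>_def by (simp only: of_real_mult mult_ac)
    finally have "(\<Sum>m. ?c m * of_real (?\<phi> m x)) = of_real (x powr (\<nu> / 2)) * S x"
      by (simp only: sums_iff)
    then show "of_real ((1 / s) powr \<rho>) * (\<Sum>m. ?c m * of_real (?\<phi> m x)) =
        of_real (x powr ((\<rho> + k) / 2)) * of_real ((sqrt (real N) / (2 * pi)) powr \<rho>) * S x"
      unfolding s1 \<nu>_def by (simp only: mult_ac)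
  next
    have c: "?c m * of_real (?\<Phi> m) = of_real (y powr (- \<rho> - 1) * (s / y) powr k / (1 / s) powr \<rho>) *
       (b (Suc m) * of_real (?e m))" for m
    proof -
      have "s\<^sup>2 * real (Suc m) / y = 4 * real (Suc m) * pi\<^sup>2 / (real N * y)" by (simp add: s2)
      then have e: "exp (- (s\<^sup>2 * real (Suc m)) / y) = ?e m" by simp
      have "?c m * of_real (?\<Phi> m) = b (Suc m) * of_real (((s\<^sup>2 * real (Suc m)) powr (\<nu> / 2) /
          real (Suc m) powr (\<nu> / 2) * y powr (- \<nu> - 1)) * ?e m)"
        unfolding e by simp
      also have "(s\<^sup>2 * real (Suc m)) powr (\<nu> / 2) / real (Suc m) powr (\<nu> / 2) * y powr (- \<nu> - 1) =
          y powr (- \<rho> - 1) * (s / y) powr k / (1 / s) powr \<rho>"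
        using powr_identity_plus[OF s, of "real (Suc m)" y \<rho> k] y s unfolding \<nu>_def
        by (simp only: eq_divide_eq) (simp add: mult_ac)
      finally show ?thesis by (simp only: of_real_mult mult_ac)
    qed
    have "(\<Sum>m. ?c m * of_real (?\<Phi> m)) = of_real (y powr (- \<rho> - 1) * (s / y) powr k / (1 / s) powr \<rho>) *
       (\<Sum>m. b (Suc m) * of_real (?e m))"
      unfolding c by (rule suminf_mult[OF sb])
    then show "of_real ((1 / s) powr \<rho>) * (\<Sum>m. ?c m * of_real (?\<Phi> m)) =
      of_real (y powr (- \<rho> - 1)) * (of_real ((2 * pi / (sqrt (real N) * y)) powr k) *
        (\<Sum>m. b (Suc m) * of_real (?e m)))"
      unfolding s1 using s by simp
  qed
qed

text \<open>Same scheme as for b^+, with the uniform bound on \<open>bessel_kernel\<close> in place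
  of the bound on J and c = n / N.\<close>

lemma has_laplace_bessel_kernel_sum:
  fixes N :: nat
  assumes b: "(\<lambda>n. norm (b n)) \<in> O(\<lambda>n. real n powr \<mu>)"
    and \<rho>: "\<rho> \<ge> 0" "k + (\<rho> - 3) / 2 \<ge> 0" "(\<rho> - 1) / 2 + k > \<mu> + 1"
    and N: "N > 0" and y: "y > 0"
    and S: "\<And>x. x > 0 \<Longrightarrow> (\<lambda>m. let n = Suc m in
           b n / of_real (real n powr ((\<rho> - 1) / 2 + k)) *
           of_real (LBINT u=0..ereal (1/2).
             u powr (k + (\<rho> - 3) / 2) / (1 - u) powr ((1 + \<rho>) / 2) *
             bessel_J (\<rho> + 1) (4 * pi * sqrt (real n * x * (1 - u) / (real N * u))))) sums S x"
  shows "has_laplace (\<lambda>x. of_real (x powr ((\<rho> + 1) / 2)) * of_real ((sqrt (real N) / (2 * pi)) powr (\<rho> + k - 1)) * S x) y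
      (of_real (y powr (- \<rho> - 1)) * (of_real ((2 * pi / (sqrt (real N) * y)) powr k) *
        (\<Sum>m. b (Suc m) * of_real (exp (4 * real (Suc m) * pi\<^sup>2 / (real N * y))
                  * upper_Gamma (1 - k) (8 * real (Suc m) * pi\<^sup>2 / (real N * y))))))"
    and "summable (\<lambda>m. b (Suc m) * complex_of_real (exp (4 * real (Suc m) * pi\<^sup>2 / (real N * y))
                  * upper_Gamma (1 - k) (8 * real (Suc m) * pi\<^sup>2 / (real N * y))))"
proof -
  let ?e = "\<lambda>m. exp (4 * real (Suc m) * pi\<^sup>2 / (real N * y))
                  * upper_Gamma (1 - k) (8 * real (Suc m) * pi\<^sup>2 / (real N * y))"
  \<comment> \<open>The dual parameter: it takes the place of y in the incomplete Gamma series for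
    b^-.\<close>
  define z where "z = 4 * pi\<^sup>2 / (real N * y)"
  have z: "z > 0" using N y by (simp add: z_def)
  have zz: "4 * real (Suc m) * pi\<^sup>2 / (real N * y) = real (Suc m) * z"
    "8 * real (Suc m) * pi\<^sup>2 / (real N * y) = 2 * real (Suc m) * z" for m
    by (simp_all add: z_def)
  show sb: "summable (\<lambda>m. b (Suc m) * complex_of_real (?e m))"
    unfolding zz by (rule summable_upper_Gamma_series[OF b z])
  define s where "s = 2 * pi / sqrt (real N)"
  have s: "s > 0" using N by (simp add: s_def)
  have s2: "4 * pi\<^sup>2 * (t / real N) = s\<^sup>2 * t" for t using N by (simp add: s_def power_divide)
  have s1: "sqrt (real N) / (2 * pi) = 1 / s" "2 * pi / (sqrt (real N) * y) = s / y"
    by (simp_all add: s_def)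
  let ?\<phi> = "\<lambda>m x. x powr ((\<rho> + 1) / 2) * bessel_kernel k \<rho> (real (Suc m) / real N) x"
  let ?\<Phi> = "\<lambda>m. (s\<^sup>2 * real (Suc m)) powr ((\<rho> + 1) / 2) * y powr (- \<rho> - 2) *
     (exp (s\<^sup>2 * real (Suc m) / y) * (s\<^sup>2 * real (Suc m) / y) powr (k - 1) *
        upper_Gamma (1 - k) (2 * (s\<^sup>2 * real (Suc m) / y)))"
  let ?c = "\<lambda>m. b (Suc m) / of_real (real (Suc m) powr ((\<rho> - 1) / 2 + k))"
  obtain C where C: "C \<ge> 0" "\<And>c x. c > 0 \<Longrightarrow> x > 0 \<Longrightarrow> \<bar>bessel_kernel k \<rho> c x\<bar> \<le> C"
    "\<And>c y. c > 0 \<Longrightarrow> y > 0 \<Longrightarrow> has_laplace (\<lambda>x. x powr ((\<rho> + 1) / 2) * bessel_kernel k \<rho> c x) y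
       ((4 * pi\<^sup>2 * c) powr ((\<rho> + 1) / 2) * y powr (- \<rho> - 2) * (exp (4 * pi\<^sup>2 * c / y) *
          (4 * pi\<^sup>2 * c / y) powr (k - 1) * upper_Gamma (1 - k) (2 * (4 * pi\<^sup>2 * c / y))))"
    by (rule bessel_kernel_bounded_and_laplace[OF \<rho>(1,2)]) (rule that)
  have "has_laplace (\<lambda>x. \<Sum>m. ?c m * of_real (?\<phi> m x)) y (\<Sum>m. ?c m * of_real (?\<Phi> m))"
  proof (rule has_laplace_dominated_series)
    show "has_laplace (?\<phi> m) y (?\<Phi> m)" for m
      using C(3)[of "real (Suc m) / real N" y] N y unfolding s2 by simp
    show "has_laplace (\<lambda>x. C * x powr ((\<rho> + 1) / 2)) y
        (C * (Gamma ((\<rho> + 1) / 2 + 1) * y powr (- ((\<rho> + 1) / 2) - 1)))"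
      by (intro has_laplace_mult has_laplace_powr) (use \<rho> y in auto)
    show "\<bar>?\<phi> m x\<bar> \<le> C * x powr ((\<rho> + 1) / 2)" if "x > 0" for m x
      using mult_left_mono[OF C(2)[of "real (Suc m) / real N" x], of "x powr ((\<rho> + 1) / 2)"] N that
      by (simp add: abs_mult mult.commute del: of_nat_Suc)
    show "summable (\<lambda>m. norm (?c m))"
      by (rule summable_coeff_powr[OF b]) (use \<rho> in simp)
  qed
  then have "has_laplace (\<lambda>x. of_real ((1 / s) powr (\<rho> + k - 1)) * (\<Sum>m. ?c m * of_real (?\<phi> m x))) y
      (of_real ((1 / s) powr (\<rho> + k - 1)) * (\<Sum>m. ?c m * of_real (?\<Phi> m)))"
    by (rule has_laplace_mult)
  then show "has_laplace (\<lambda>x. of_real (x powr ((\<rho> + 1) / 2)) * of_real ((sqrt (real N) / (2 * pi)) powr (\<rho> + k - 1)) * S x) y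
      (of_real (y powr (- \<rho> - 1)) * (of_real ((2 * pi / (sqrt (real N) * y)) powr k) *
        (\<Sum>m. b (Suc m) * of_real (?e m))))"
  proof (rule has_laplace_cong[THEN iffD1, rotated -1])
    fix x :: real assume x: "x > 0"
    have j: "real (Suc m) * x * (1 - u) / (real N * u) = real (Suc m) / real N * x * (1 - u) / u" for m u
      by simp
    have "(\<lambda>m. of_real (x powr ((\<rho> + 1) / 2)) * (?c m * of_real (bessel_kernel k \<rho> (real (Suc m) / real N) x)))
         sums (of_real (x powr ((\<rho> + 1) / 2)) * S x)"
      using S[OF x] unfolding Let_def j bessel_kernel_def[symmetric] by (intro sums_mult)
    also have "(\<lambda>m. of_real (x powr ((\<rho> + 1) / 2)) * (?c m * of_real (bessel_kernel k \<rho> (real (Suc m) / real N) x))) =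
        (\<lambda>m. ?c m * of_real (?\<phi> m x))"
      by (simp only: of_real_mult mult_ac)
    finally have "(\<Sum>m. ?c m * of_real (?\<phi> m x)) = of_real (x powr ((\<rho> + 1) / 2)) * S x"
      by (simp only: sums_iff)
    then show "of_real ((1 / s) powr (\<rho> + k - 1)) * (\<Sum>m. ?c m * of_real (?\<phi> m x)) =
        of_real (x powr ((\<rho> + 1) / 2)) * of_real ((sqrt (real N) / (2 * pi)) powr (\<rho> + k - 1)) * S x"
      unfolding s1 by (simp only: mult_ac)
  next
    have c: "?c m * of_real (?\<Phi> m) = of_real (y powr (- \<rho> - 1) * (s / y) powr k / (1 / s) powr (\<rho> + k - 1)) *
       (b (Suc m) * of_real (?e m))" for m
    proof -
      have "s\<^sup>2 * real (Suc m) / y = real (Suc m) * z"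
        unfolding s2[symmetric] z_def by simp
      then have e: "exp (s\<^sup>2 * real (Suc m) / y) * upper_Gamma (1 - k) (2 * (s\<^sup>2 * real (Suc m) / y)) = ?e m"
        unfolding zz by (simp add: mult_ac)
      have "?c m * of_real (?\<Phi> m) = b (Suc m) * of_real (((s\<^sup>2 * real (Suc m)) powr ((\<rho> + 1) / 2) /
          real (Suc m) powr ((\<rho> - 1) / 2 + k) * y powr (- \<rho> - 2) * (s\<^sup>2 * real (Suc m) / y) powr (k - 1)) * ?e m)"
        unfolding e[symmetric] by simp
      also have "(s\<^sup>2 * real (Suc m)) powr ((\<rho> + 1) / 2) /
          real (Suc m) powr ((\<rho> - 1) / 2 + k) * y powr (- \<rho> - 2) * (s\<^sup>2 * real (Suc m) / y) powr (k - 1) =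
          y powr (- \<rho> - 1) * (s / y) powr k / (1 / s) powr (\<rho> + k - 1)"
        using powr_identity_minus[OF s, of "real (Suc m)" y \<rho> k] y s
        by (simp only: eq_divide_eq) (simp add: mult_ac)
      finally show ?thesis by (simp only: of_real_mult mult_ac)
    qed
    have "(\<Sum>m. ?c m * of_real (?\<Phi> m)) = of_real (y powr (- \<rho> - 1) * (s / y) powr k / (1 / s) powr (\<rho> + k - 1)) *
       (\<Sum>m. b (Suc m) * of_real (?e m))"
      unfolding c by (rule suminf_mult[OF sb])
    then show "of_real ((1 / s) powr (\<rho> + k - 1)) * (\<Sum>m. ?c m * of_real (?\<Phi> m)) =
      of_real (y powr (- \<rho> - 1)) * (of_real ((2 * pi / (sqrt (real N) * y)) powr k) *
        (\<Sum>m. b (Suc m) * of_real (?e m)))"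
      unfolding s1 using s by simp
  qed
qed

section \<open>Comparison of the two transforms\<close>

theorem theorem7p1:
  fixes k :: real and N :: nat
    and ap am bp bm :: "nat \<Rightarrow> complex"
    and \<mu>fp \<mu>fm \<mu>gp \<mu>gm :: real
  assumes "2 * k \<in> \<int>" and "k < 2" and "N > 0"
    and "\<mu>fp \<ge> 0" and "\<mu>fm \<ge> 0" and "\<mu>gp \<ge> 0" and "\<mu>gm \<ge> 0"
    and "(\<lambda>n. norm (ap n)) \<in> O(\<lambda>n. real n powr \<mu>fp)"
    and "(\<lambda>n. norm (am n)) \<in> O(\<lambda>n. real n powr \<mu>fm)"
    and "(\<lambda>n. norm (bp n)) \<in> O(\<lambda>n. real n powr \<mu>gp)"
    and "(\<lambda>n. norm (bm n)) \<in> O(\<lambda>n. real n powr \<mu>gm)"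
    and "\<And>\<rho> x :: real.
      \<rho> > max (1 - k) (max (\<mu>gp - k / 2 + 3 / 4) (2 * \<mu>gm - 2 * k + 5 / 2)) \<Longrightarrow> x > 0 \<Longrightarrow>
      \<exists>S1 S2 :: complex.
        (\<lambda>m. let n = Suc m in
           bp n / of_real (real n powr ((\<rho> + k) / 2)) *
           of_real (bessel_J (\<rho> + k) (4 * pi * sqrt (real n * x / real N)))) sums S1 \<and>
        (\<lambda>m. let n = Suc m in
           bm n / of_real (real n powr ((\<rho> - 1) / 2 + k)) *
           of_real (LBINT u=0..ereal (1/2).
             u powr (k + (\<rho> - 3) / 2) / (1 - u) powr ((1 + \<rho>) / 2) *
             bessel_J (\<rho> + 1) (4 * pi * sqrt (real n * x * (1 - u) / (real N * u))))) sums S2 \<and>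
        1 / of_real (Gamma (\<rho> + 1)) *
            (\<Sum>n\<in>{n::nat. 1 \<le> n \<and> real n \<le> x}. ap n * of_real ((x - real n) powr \<rho>))
          + of_real (x powr \<rho>) / (2 * of_real pi * \<i>) *
            (\<Sum>n\<in>{n::nat. 1 \<le> n \<and> real n \<le> x}. am n * g_fun k \<rho> n x)
          - Q_fun k N ap am bp bm \<rho> x
        = - (\<i> powr of_real k * of_real (x powr ((\<rho> + k) / 2))
              * of_real ((sqrt (real N) / (2 * pi)) powr \<rho>) * S1)
          - \<i> powr of_real k * of_real (x powr ((\<rho> + 1) / 2))
              * of_real ((sqrt (real N) / (2 * pi)) powr (\<rho> + k - 1)) * S2"
  shows "\<forall>y::real. y > 0 \<longrightarrow>
    (\<exists>T1 T2 T3 T4 :: complex.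
      (\<lambda>m. let n = Suc m in ap n * of_real (exp (- (real n * y)))) sums T1 \<and>
      (\<lambda>m. let n = Suc m in
         am n * of_real (exp (real n * y) * upper_Gamma (1 - k) (2 * real n * y))) sums T2 \<and>
      (\<lambda>m. let n = Suc m in
         bp n * of_real (exp (- (4 * real n * pi\<^sup>2 / (real N * y))))) sums T3 \<and>
      (\<lambda>m. let n = Suc m in
         bm n * of_real (exp (4 * real n * pi\<^sup>2 / (real N * y))
                  * upper_Gamma (1 - k) (8 * real n * pi\<^sup>2 / (real N * y)))) sums T4 \<and>
      T1 + T2 + ap 0
        - of_real (2 * pi * real N powr (k / 2 - 1)) * \<i> powr of_real k / of_real y * bm 0
        + of_real ((2 * pi) powr (k - 1) / y powr (k - 1)) * am 0
        - \<i> powr of_real k * of_real ((2 * pi) powr k)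
            / of_real (real N powr (k / 2) * y powr k) * bp 0
      = - ((2 * of_real pi * \<i> / of_real (sqrt (real N) * y)) powr of_real k * T3)
        - (2 * of_real pi * \<i> / of_real (sqrt (real N) * y)) powr of_real k * T4)"
proof (intro allI impI)
  fix y :: real assume y: "y > 0"
  obtain c where c: "k \<le> c" "- k \<le> c"
    using abs_ge_self abs_ge_minus_self by metis
  \<comment> \<open>\<open>c\<close> is an upper bound for |k|. The conditions below contain rho / 2
    next to k and the exponents mu, so doubled exponents and 4 c leave room in all of them at
    once.\<close>
  define \<rho> where "\<rho> = 10 + 4 * c + 2 * \<mu>gp + 2 * \<mu>gm"
  have \<rho>: "\<rho> > max (1 - k) (max (\<mu>gp - k / 2 + 3 / 4) (2 * \<mu>gm - 2 * k + 5 / 2))"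
    "\<rho> > 0" "k + \<rho> > 1" "\<rho> + k \<ge> 0" "(\<rho> + k) / 2 > \<mu>gp + 1"
    "k + (\<rho> - 3) / 2 \<ge> 0" "(\<rho> - 1) / 2 + k > \<mu>gm + 1"
    unfolding max_less_iff_conj by (insert c \<rho>_def assms(6,7)) ((intro conjI)?; simp add: field_simps)+
  let ?s1 = "\<lambda>x m. let n = Suc m in
           bp n / of_real (real n powr ((\<rho> + k) / 2)) *
           of_real (bessel_J (\<rho> + k) (4 * pi * sqrt (real n * x / real N)))"
  let ?s2 = "\<lambda>x m. let n = Suc m in
           bm n / of_real (real n powr ((\<rho> - 1) / 2 + k)) *
           of_real (LBINT u=0..ereal (1/2).
             u powr (k + (\<rho> - 3) / 2) / (1 - u) powr ((1 + \<rho>) / 2) *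
             bessel_J (\<rho> + 1) (4 * pi * sqrt (real n * x * (1 - u) / (real N * u))))"
  let ?A1 = "\<lambda>x. 1 / of_real (Gamma (\<rho> + 1)) *
            (\<Sum>n\<in>{n::nat. 1 \<le> n \<and> real n \<le> x}. ap n * of_real ((x - real n) powr \<rho>))"
  let ?A2 = "\<lambda>x. of_real (x powr \<rho>) / (2 * of_real pi * \<i>) *
            (\<Sum>n\<in>{n::nat. 1 \<le> n \<and> real n \<le> x}. am n * g_fun k \<rho> n x)"
  let ?Q = "Q_fun k N ap am bp bm \<rho>"
  let ?W = "\<i> powr of_real k"
  let ?B1 = "\<lambda>x. of_real (x powr ((\<rho> + k) / 2)) * of_real ((sqrt (real N) / (2 * pi)) powr \<rho>) * (\<Sum>m. ?s1 x m)"
  let ?B2 = "\<lambda>x. of_real (x powr ((\<rho> + 1) / 2)) * of_real ((sqrt (real N) / (2 * pi)) powr (\<rho> + k - 1)) * (\<Sum>m. ?s2 x m)"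
  \<comment> \<open>The sums granted by the hypothesis depend on x; naming them as
    \<open>suminf\<close> turns them into functions that can be transformed. The difference is
    rewritten as a sum to fit linearity.\<close>
  have s1: "?s1 x sums (\<Sum>m. ?s1 x m)" and s2: "?s2 x sums (\<Sum>m. ?s2 x m)"
    and identity: "?A1 x + ?A2 x + (- 1) * ?Q x = (- ?W) * ?B1 x + (- ?W) * ?B2 x" if x: "x > 0" for x
  proof -
    obtain S1 S2 where S: "?s1 x sums S1" "?s2 x sums S2"
      and eq: "?A1 x + ?A2 x - ?Q x =
          - (?W * of_real (x powr ((\<rho> + k) / 2)) * of_real ((sqrt (real N) / (2 * pi)) powr \<rho>) * S1)
          - ?W * of_real (x powr ((\<rho> + 1) / 2)) * of_real ((sqrt (real N) / (2 * pi)) powr (\<rho> + k - 1)) * S2"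
      using assms(12)[OF \<rho>(1) x] by (elim exE conjE) (rule that)
    have S': "S1 = (\<Sum>m. ?s1 x m)" "S2 = (\<Sum>m. ?s2 x m)"
      by (rule sums_unique[OF S(1)], rule sums_unique[OF S(2)])
    show "?s1 x sums (\<Sum>m. ?s1 x m)" using S(1) unfolding S'(1) .
    show "?s2 x sums (\<Sum>m. ?s2 x m)" using S(2) unfolding S'(2) .
    show "?A1 x + ?A2 x + (- 1) * ?Q x = (- ?W) * ?B1 x + (- ?W) * ?B2 x"
      using eq unfolding S' by (simp only: mult_minus_left mult_1 diff_conv_add_uminus mult.assoc)
  qed
  define Y where "Y = complex_of_real (y powr (- \<rho> - 1))"
  define T1 where "T1 = (\<Sum>m. ap (Suc m) * complex_of_real (exp (- (real (Suc m) * y))))"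
  define T2 where "T2 = (\<Sum>m. am (Suc m) * complex_of_real
      (exp (real (Suc m) * y) * upper_Gamma (1 - k) (2 * real (Suc m) * y)))"
  define T3 where "T3 = (\<Sum>m. bp (Suc m) * complex_of_real (exp (- (4 * real (Suc m) * pi\<^sup>2 / (real N * y)))))"
  define T4 where "T4 = (\<Sum>m. bm (Suc m) * complex_of_real (exp (4 * real (Suc m) * pi\<^sup>2 / (real N * y))
                  * upper_Gamma (1 - k) (8 * real (Suc m) * pi\<^sup>2 / (real N * y))))"
  \<comment> \<open>\<open>Y * R\<close> is the transform of Q; - R is the block of index-0 terms in
    the conclusion.\<close>
  define R where "R = - ap 0 + of_real (2 * pi * real N powr (k / 2 - 1)) * ?W / of_real y * bm 0
        - of_real ((2 * pi) powr (k - 1) / y powr (k - 1)) * am 0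
        + ?W * of_real ((2 * pi) powr k) / of_real (real N powr (k / 2) * y powr k) * bp 0"
  define P where "P = complex_of_real ((2 * pi / (sqrt (real N) * y)) powr k)"
  note L1 = has_laplace_Riesz_sum[OF assms(8) \<rho>(2) y, folded Y_def T1_def]
  note L2 = has_laplace_g_fun_sum[OF assms(9) \<rho>(3) y, folded Y_def T2_def]
  note LQ = has_laplace_Q_fun[OF \<rho>(2,3) y, of N ap am bp bm, folded Y_def R_def]
  note L3 = has_laplace_bessel_sum[OF assms(10) \<rho>(4,5) assms(3) y s1, folded Y_def T3_def P_def]
  note L4 = has_laplace_bessel_kernel_sum[OF assms(11) less_imp_le[OF \<rho>(2)] \<rho>(6,7) assms(3) y s2,
      folded Y_def T4_def P_def]
  have "has_laplace (\<lambda>x. ?A1 x + ?A2 x + (- 1) * ?Q x) y (Y * T1 + Y * T2 + (- 1) * (Y * R))"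
    by (intro has_laplace_add L1(1) L2 has_laplace_mult LQ)
  \<comment> \<open>The identity carries this transform over to the Bessel side, where
    \<open>L3\<close> and \<open>L4\<close> compute it a second time.\<close>
  then have "has_laplace (\<lambda>x. (- ?W) * ?B1 x + (- ?W) * ?B2 x) y (Y * T1 + Y * T2 + (- 1) * (Y * R))"
    by (rule has_laplace_cong[THEN iffD1, rotated -1]) (erule identity, rule refl)
  moreover have "has_laplace (\<lambda>x. (- ?W) * ?B1 x + (- ?W) * ?B2 x) y
      ((- ?W) * (Y * (P * T3)) + (- ?W) * (Y * (P * T4)))"
    by (intro has_laplace_add has_laplace_mult L3(1) L4(1))
  ultimately have "Y * T1 + Y * T2 + (- 1) * (Y * R) = (- ?W) * (Y * (P * T3)) + (- ?W) * (Y * (P * T4))"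
    by (rule has_laplace_unique)
  then have "Y * (T1 + T2 - R) = Y * (- (P * ?W * T3) - P * ?W * T4)"
    by (simp add: algebra_simps)
  \<comment> \<open>Cancelling Y = y^(-rho-1) removes the last trace of rho.\<close>
  moreover have "Y \<noteq> 0" using y by (simp add: Y_def)
  ultimately have main: "T1 + T2 - R = - (P * ?W * T3) - P * ?W * T4" by simp
  \<comment> \<open>The principal power is multiplicative here because one factor is a positive
    real.\<close>
  have PW: "(2 * of_real pi * \<i> / of_real (sqrt (real N) * y)) powr of_real k = P * ?W"
  proof -
    have "2 * of_real pi * \<i> / of_real (sqrt (real N) * y) = complex_of_real (2 * pi / (sqrt (real N) * y)) * \<i>"
      by simp
    moreover have "(complex_of_real (2 * pi / (sqrt (real N) * y)) * \<i>) powr of_real k =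
        complex_of_real (2 * pi / (sqrt (real N) * y)) powr of_real k * ?W"
      using y by (intro powr_times_real_left) auto
    moreover have "complex_of_real (2 * pi / (sqrt (real N) * y)) powr of_real k = P"
      unfolding P_def using y by (intro powr_of_real) auto
    ultimately show ?thesis by simp
  qed
  show "\<exists>T1 T2 T3 T4 :: complex.
      (\<lambda>m. let n = Suc m in ap n * of_real (exp (- (real n * y)))) sums T1 \<and>
      (\<lambda>m. let n = Suc m in
         am n * of_real (exp (real n * y) * upper_Gamma (1 - k) (2 * real n * y))) sums T2 \<and>
      (\<lambda>m. let n = Suc m in
         bp n * of_real (exp (- (4 * real n * pi\<^sup>2 / (real N * y))))) sums T3 \<and>
      (\<lambda>m. let n = Suc m in
         bm n * of_real (exp (4 * real n * pi\<^sup>2 / (real N * y))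
                  * upper_Gamma (1 - k) (8 * real n * pi\<^sup>2 / (real N * y)))) sums T4 \<and>
      T1 + T2 + ap 0
        - of_real (2 * pi * real N powr (k / 2 - 1)) * \<i> powr of_real k / of_real y * bm 0
        + of_real ((2 * pi) powr (k - 1) / y powr (k - 1)) * am 0
        - \<i> powr of_real k * of_real ((2 * pi) powr k)
            / of_real (real N powr (k / 2) * y powr k) * bp 0
      = - ((2 * of_real pi * \<i> / of_real (sqrt (real N) * y)) powr of_real k * T3)
        - (2 * of_real pi * \<i> / of_real (sqrt (real N) * y)) powr of_real k * T4"
  proof (intro exI conjI)
    show "(\<lambda>m. let n = Suc m in ap n * of_real (exp (- (real n * y)))) sums T1"
      unfolding Let_def T1_def by (rule summable_sums[OF L1(2)])
    show "(\<lambda>m. let n = Suc m in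
         am n * of_real (exp (real n * y) * upper_Gamma (1 - k) (2 * real n * y))) sums T2"
      unfolding Let_def T2_def by (rule summable_sums[OF summable_upper_Gamma_series(2)[OF assms(9) y]])
    show "(\<lambda>m. let n = Suc m in
         bp n * of_real (exp (- (4 * real n * pi\<^sup>2 / (real N * y))))) sums T3"
      unfolding Let_def T3_def by (rule summable_sums[OF L3(2)])
    show "(\<lambda>m. let n = Suc m in
         bm n * of_real (exp (4 * real n * pi\<^sup>2 / (real N * y))
                  * upper_Gamma (1 - k) (8 * real n * pi\<^sup>2 / (real N * y)))) sums T4"
      unfolding Let_def T4_def by (rule summable_sums[OF L4(2)])
    show "T1 + T2 + ap 0
        - of_real (2 * pi * real N powr (k / 2 - 1)) * \<i> powr of_real k / of_real y * bm 0
        + of_real ((2 * pi) powr (k - 1) / y powr (k - 1)) * am 0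
        - \<i> powr of_real k * of_real ((2 * pi) powr k)
            / of_real (real N powr (k / 2) * y powr k) * bp 0
      = - ((2 * of_real pi * \<i> / of_real (sqrt (real N) * y)) powr of_real k * T3)
        - (2 * of_real pi * \<i> / of_real (sqrt (real N) * y)) powr of_real k * T4"
      unfolding PW main[symmetric] R_def by (simp only: diff_conv_add_uminus minus_add_distrib minus_minus add.assoc)
  qed
qed

end
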